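(* Let $l\ge 2$ be an integer, $\lambda\in\mathbb{Q}\setminus\{0,-1\}$, $p$ an odd prime with $\mathrm{ord}_p(\lambda(\lambda+1))=0$, and $q=p^e\equiv 1\pmod l$. Let $S$ be a multiplicative character of order $l$ on $\mathbb{F}_q$. If $3\nmid l$ and $\frac{q-1}{l}$ is even, then $$-a_q(C_{l,\lambda})=q\sum_{i=1}^{l-1}\frac{J(\phi,S^{-i})}{J(\sqrt{S^i},\sqrt{S^{-3i}}\,\phi)}\; {}_2F_1\left(\begin{array}{cc}\sqrt{S^{3i}}\,\phi, & \sqrt{S^{3i}}\\ & S^{2i}\end{array}\Big|\ 1+\lambda\right).$$ For $l=3$, $$-a_q(C_{l,\lambda})=2+q\sum_{i=1}^{2}{}_2F_1\left(\begin{array}{cc}\phi, & \varepsilon\\ & S^i\end{array}\Big|\ 1+\lambda\right).$$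
   Context: $q=p^e$ is a power of an odd prime $p$. Multiplicative characters on $\mathbb{F}_q^\times$ are complex valued and are all (including the trivial one) extended to $\mathbb{F}_q$ by $\chi(0):=0$; $\varepsilon$ is the trivial and $\phi$ the quadratic character; $\overline{B}$ is the inverse of $B$. $J(A,B)=\sum_{x\in\mathbb{F}_q}A(x)B(1-x)$ is the Jacobi sum. The binomial coefficient is $\binom{A}{B}:=\frac{B(-1)}{q}J(A,\overline{B})$. Gaussian hypergeometric series: $${}_2F_1\left(\begin{array}{cc}A_0,&A_1\\&B_1\end{array}\Big|\ x\right):=\frac{q}{q-1}\sum_{\chi}\binom{A_0\chi}{\chi}\binom{A_1\chi}{B_1\chi}\chi(x),$$ the sum being over all multiplicative characters $\chi$ of $\mathbb{F}_q$. Rational numbers with denominator prime to $p$ are regarded as elements of $\mathbb{F}_q$ by reduction mod $p$. When $\frac{q-1}{l}$ is even, $S$ is the square of a character; $\sqrt{S^i}$ denotes a character whose square is $S^i$, with consistent choices: $\sqrt{S^{ki}}=(\sqrt{S^{i}})^k$ for integers $k$. $C_{l,\lambda}$ is the nonsingular projective algebraic curve over $\mathbb{Q}$ with affine equation $y^l=(x-1)(x^2+\lambda)$. For a prime $p$ of good reduction and $q=p^e$, $a_q(C_{l,\lambda}):=1+q-\#C_{l,\lambda}(\mathbb{F}_q)$, where $\#C_{l,\lambda}(\mathbb{F}_q)$ is the number of $\mathbb{F}_q$-points. With $N=\#\{(x,y)\in\mathbb{F}_q^2: y^l=(x-1)(x^2+\lambda)\}$, one has $\#C_{l,\lambda}(\mathbb{F}_q)=1+N$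 for $l\neq 3$, and $\#C_{3,\lambda}(\mathbb{F}_q)=3+N$ for $l=3$ and $q\equiv 1\pmod 3$. A prime $p\nmid l$ is of good reduction iff $\mathrm{ord}_p(\lambda(\lambda+1))=0$. *)

theory Defs
  imports
    Complex_Main
    "HOL-Library.Cardinality"
    "HOL-Library.FuncSet"
    "HOL-Computational_Algebra.Polynomial"
    "HOL-Number_Theory.Cong"
begin

typedef (overloaded) ('a :: field) mchar =
    "{\<chi> :: 'a \<Rightarrow> complex. \<chi> 0 = 0 \<and> \<chi> 1 = 1 \<and> (\<forall>x y. \<chi> (x * y) = \<chi> x * \<chi> y)}"
  morphisms mchar_apply Abs_mchar
  by (rule exI[of _ "\<lambda>x. if x = 0 then 0 else 1"]) auto

setup_lifting type_definition_mchar

text \<open>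
  Characters form a group under pointwise multiplication.  All of them, including the
  trivial character \<open>1\<close>, vanish at \<open>0\<close>; in particular \<^term>\<open>S powi 0\<close> does too.
\<close>

instantiation mchar :: (field) "{comm_monoid_mult, inverse}"
begin

lift_definition one_mchar :: "'a mchar" is "\<lambda>x. if x = 0 then 0 else 1"
  by auto

lift_definition times_mchar :: "'a mchar \<Rightarrow> 'a mchar \<Rightarrow> 'a mchar" is "\<lambda>A B x. A x * B x"
  by auto

lift_definition inverse_mchar :: "'a mchar \<Rightarrow> 'a mchar" is "\<lambda>A x. inverse (A x)"
  by auto

definition divide_mchar :: "'a mchar \<Rightarrow> 'a mchar \<Rightarrow> 'a mchar" where
  "divide_mchar A B = A * inverse B"

instance
proof
  fix A B C :: "'a mchar"
  show "A * B * C = A * (B * C)" by transfer (simp add: mult.assoc)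
  show "A * B = B * A" by transfer (simp add: mult.commute)
  show "1 * A = A" by transfer (auto simp: fun_eq_iff)
qed

end

lemma mchar_apply_0 [simp]: "mchar_apply A 0 = 0"
  and mchar_apply_1 [simp]: "mchar_apply A 1 = 1"
  and mchar_apply_mult: "mchar_apply A (x * y) = mchar_apply A x * mchar_apply A y"
  using mchar_apply[of A] by auto

lemma mchar_mult_apply [simp]: "mchar_apply (A * B) x = mchar_apply A x * mchar_apply B x"
  by transfer simp

lemma mchar_inverse_apply [simp]: "mchar_apply (inverse A) x = inverse (mchar_apply A x)"
  by transfer simp

lemma mchar_one_apply: "mchar_apply 1 x = (if x = 0 then 0 else 1)"
  by transfer simp

lemma mchar_eq_0_iff [simp]: "mchar_apply A x = 0 \<longleftrightarrow> x = 0"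
proof
  assume "mchar_apply A x = 0"
  hence "mchar_apply A (x * inverse x) = 0" by (simp add: mchar_apply_mult)
  thus "x = 0" by (cases "x = 0") auto
qed auto

lemma mchar_mult_inverse [simp]: "A * inverse A = (1 :: 'a :: field mchar)"
  by (simp add: mchar_apply_inject[symmetric] fun_eq_iff mchar_one_apply)

lemma mchar_apply_power: "mchar_apply A (x ^ n) = mchar_apply A x ^ n"
  by (induction n) (simp_all add: mchar_apply_mult)

instance mchar :: (finite_field) finite
proof
  let ?n = "CARD('a) - 1"
  let ?V = "insert (0 :: complex) {z. z ^ ?n = 1}"
  have card: "CARD('a) > 1"
    using card_mono[of UNIV "{0, 1 :: 'a}"] by simp
  hence n: "?n > 0" by simp
  have val: "mchar_apply A x \<in> ?V" for A :: "'a mchar" and x :: 'a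
  proof (cases "x = 0")
    case False
    have "x * x ^ ?n = x ^ CARD('a)"
      using card by (cases "CARD('a)") simp_all
    hence "x ^ ?n = 1" using False finite_field_power_card_eq_same[of x] by simp
    hence "mchar_apply A x ^ ?n = 1" by (metis mchar_apply_power mchar_apply_1)
    thus ?thesis by simp
  qed simp
  have "range (mchar_apply :: 'a mchar \<Rightarrow> _) \<subseteq> PiE UNIV (\<lambda>_. ?V)"
    by (rule image_subsetI, rule PiE_I[OF val]) simp
  moreover have "finite ?V"
    using finite_roots_unity[of ?n, where 'a = complex] n by simp
  hence "finite (PiE (UNIV :: 'a set) (\<lambda>_. ?V))" by (intro finite_PiE) auto
  ultimately have "finite (range (mchar_apply :: 'a mchar \<Rightarrow> _))"
    by (rule finite_subset)
  thus "finite (UNIV :: 'a mchar set)"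
    by (rule finite_imageD) (auto simp: inj_on_def mchar_apply_inject)
qed

definition mchar_has_order :: "'a :: field mchar \<Rightarrow> nat \<Rightarrow> bool" where
  "mchar_has_order S n \<longleftrightarrow> n > 0 \<and> S ^ n = 1 \<and> (\<forall>k. 0 < k \<and> k < n \<longrightarrow> S ^ k \<noteq> 1)"

lemma nonsquare_mult_nonsquare:
  fixes a b :: "'a :: finite_field"
  assumes a: "\<nexists>z. a = z ^ 2" and b: "\<nexists>z. b = z ^ 2"
  shows "\<exists>z. a * b = z ^ 2"
proof -
  define Q where "Q = {x :: 'a. x \<noteq> 0 \<and> (\<exists>z. x = z ^ 2)}"
  define N where "N = {x :: 'a. \<nexists>z. x = z ^ 2}"
  have [simp]: "a \<noteq> 0" using a by force
  have U: "UNIV - {0} = Q \<union> N" and disj: "Q \<inter> N = {}"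
    by (auto simp: Q_def N_def)
  have "card (\<Union>s\<in>Q. {y. y ^ 2 = s}) \<le> (\<Sum>s\<in>Q. card {y. y ^ 2 = s})"
    by (rule card_UN_le) simp
  also have "\<dots> \<le> (\<Sum>s\<in>Q. 2)"
  proof (rule sum_mono)
    fix s assume "s \<in> Q"
    then obtain z where "s = z ^ 2" by (auto simp: Q_def)
    hence "{y. y ^ 2 = s} \<subseteq> {z, -z}" by (auto simp: power2_eq_iff)
    hence "card {y. y ^ 2 = s} \<le> card {z, -z}" by (rule card_mono[rotated]) simp
    also have "\<dots> \<le> 2" by (simp add: card_insert_if)
    finally show "card {y. y ^ 2 = s} \<le> 2" .
  qed
  also have "(\<Union>s\<in>Q. {y. y ^ 2 = s}) = UNIV - {0}" by (auto simp: Q_def)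
  finally have "card Q + card N \<le> 2 * card Q"
    using disj unfolding U by (subst (asm) card_Un_disjoint) auto
  hence le: "card N \<le> card Q" by simp
  have "(*) a ` Q \<subseteq> N"
  proof safe
    fix x assume "x \<in> Q"
    then obtain z where z: "x = z ^ 2" "z \<noteq> 0" by (auto simp: Q_def)
    show "a * x \<in> N"
      unfolding N_def
    proof safe
      fix w assume "a * x = w ^ 2"
      hence "a = (w / z) ^ 2" using z by (simp add: field_simps power_divide)
      with a show False by blast
    qed
  qed
  moreover have "card ((*) a ` Q) = card Q"
    by (rule card_image) (auto simp: inj_on_def)
  ultimately have "(*) a ` Q = N"
    using le by (intro card_seteq) auto
  moreover have "b \<in> N" using b by (simp add: N_def)
  ultimately obtain s where "s \<in> Q" "b = a * s" by blast
  then obtain z where "b = a * z ^ 2" by (auto simp: Q_def)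
  hence "a * b = (a * z) ^ 2" by (simp add: power2_eq_square mult_ac)
  thus ?thesis by blast
qed

lift_definition quadratic_mchar :: "'a :: finite_field mchar" is
  "\<lambda>x. if x = 0 then 0 else if \<exists>z. x = z ^ 2 then 1 else -1"
proof -
  have sq_mult: "(\<exists>z. x * y = z ^ 2) \<longleftrightarrow> ((\<exists>z. x = z ^ 2) \<longleftrightarrow> (\<exists>z. y = z ^ 2))"
    if "x \<noteq> 0" "y \<noteq> 0" for x y :: 'a
  proof -
    have 1: "\<exists>z. v = z ^ 2" if h: "u * v = w ^ 2" "u = z ^ 2" "u \<noteq> 0" for u v w z :: 'a
      using h by (intro exI[of _ "w / z"]) (simp add: field_simps power_divide)
    have 2: "\<exists>z. u * v = z ^ 2" if "u = w ^ 2" "v = z ^ 2" for u v w z :: 'a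
      using that by (metis power_mult_distrib)
    show ?thesis
      using that 1[of x y] 1[of y x] 2 nonsquare_mult_nonsquare[of x y]
      by (metis mult.commute)
  qed
  have "\<exists>z. (1 :: 'a) = z ^ 2" by (rule exI[of _ 1]) simp
  thus "?thesis" using sq_mult by auto
qed

definition jacobi_sum :: "'a :: finite_field mchar \<Rightarrow> 'a mchar \<Rightarrow> complex" where
  "jacobi_sum A B = (\<Sum>x\<in>UNIV. mchar_apply A x * mchar_apply B (1 - x))"

definition mchar_binomial :: "'a :: finite_field mchar \<Rightarrow> 'a mchar \<Rightarrow> complex" where
  "mchar_binomial A B = mchar_apply B (-1) / of_nat CARD('a) * jacobi_sum A (inverse B)"

definition gauss_2F1 ::
  "'a :: finite_field mchar \<Rightarrow> 'a mchar \<Rightarrow> 'a mchar \<Rightarrow> 'a \<Rightarrow> complex" where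
  "gauss_2F1 A0 A1 B1 x =
     of_nat CARD('a) / (of_nat CARD('a) - 1) *
       (\<Sum>\<chi>\<in>UNIV. mchar_binomial (A0 * \<chi>) \<chi> * mchar_binomial (A1 * \<chi>) (B1 * \<chi>) * mchar_apply \<chi> x)"

text \<open>
  \<^term>\<open>quotient_of r\<close> is the pair of numerator and (positive) denominator of \<open>r\<close> in lowest
  terms.  The value \<open>rat_ord p 0 = 0\<close> is a dummy.
\<close>

definition rat_ord :: "nat \<Rightarrow> rat \<Rightarrow> int" where
  "rat_ord p r = int (multiplicity (int p) (fst (quotient_of r)))
               - int (multiplicity (int p) (snd (quotient_of r)))"

text \<open>Reduction is meaningful only if the denominator is prime to the characteristic.\<close>

definition rat_red :: "rat \<Rightarrow> 'a :: field" where
  "rat_red r = of_int (fst (quotient_of r)) / of_int (snd (quotient_of r))"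

text \<open>
  The nonsingular projective model of \<open>y\<^sup>l = (x - 1)(x\<^sup>2 + a)\<close>.  With \<open>d = gcd l 3\<close>, it is the
  curve \<open>Y\<^sup>l = (X - Z\<^bsup>l/d\<^esup>)(X\<^sup>2 + a Z\<^bsup>2l/d\<^esup>)\<close> in the weighted projective plane
  with weights \<open>(l/d, 3/d, 1)\<close> for \<open>(X, Y, Z)\<close>; for \<open>l = 3\<close> this is the ordinary plane cubic.
  The affine equation is its part \<open>Z = 1\<close>.  At a point with \<open>Z = 0\<close> both \<open>X\<close> and \<open>Y\<close>
  are nonzero.  So the weighted action of the multiplicative group is free on the solutions,
  and the points over the field \<open>'a\<close> are the orbits of its nonzero solutions.  If \<open>l\<close>, \<open>2\<close>,
  \<open>a\<close> and \<open>a + 1\<close> are nonzero in \<open>'a\<close>, the curve is nonsingular: the partial derivative with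
  respect to \<open>Y\<close> does not vanish at \<open>Z = 0\<close>, and the cubic polynomial has discriminant
  \<open>-4a(a+1)\<^sup>2\<close>.
\<close>

definition curve_solutions :: "nat \<Rightarrow> 'a :: field \<Rightarrow> ('a \<times> 'a \<times> 'a) set" where
  "curve_solutions l a = {(X, Y, Z). (X, Y, Z) \<noteq> (0, 0, 0) \<and>
     Y ^ l = (X - Z ^ (l div gcd l 3)) * (X ^ 2 + a * Z ^ (2 * (l div gcd l 3)))}"

definition weighted_rel :: "nat \<Rightarrow> (('a :: field \<times> 'a \<times> 'a) \<times> ('a \<times> 'a \<times> 'a)) set" where
  "weighted_rel l = {((X, Y, Z), (X', Y', Z')).
     \<exists>t. t \<noteq> 0 \<and> X' = t ^ (l div gcd l 3) * X \<and> Y' = t ^ (3 div gcd l 3) * Y \<and> Z' = t * Z}"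

definition curve_points :: "nat \<Rightarrow> 'a :: field \<Rightarrow> ('a \<times> 'a \<times> 'a) set set" where
  "curve_points l a = curve_solutions l a // weighted_rel l"

text \<open>
  The value \<open>a\<^sub>q(C)\<close> over the field \<open>'a\<close> with \<open>q\<close> elements, for a curve with rational parameter
  \<open>lam\<close> that has good reduction.
\<close>

definition curve_trace :: "'a :: finite_field itself \<Rightarrow> nat \<Rightarrow> rat \<Rightarrow> int" where
  "curve_trace _ l lam = 1 + int CARD('a) - int (card (curve_points l (rat_red lam :: 'a)))"

definition affine_points :: "nat \<Rightarrow> 'a :: field \<Rightarrow> ('a \<times> 'a) set" where
  "affine_points l a = {(x, y). y ^ l = (x - 1) * (x ^ 2 + a)}"

lemma equiv_weighted_rel: "equiv UNIV (weighted_rel l :: (('a :: field \<times> 'a \<times> 'a) \<times> _) set)"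
proof (rule equivI)
  show "refl (weighted_rel l :: (('a \<times> 'a \<times> 'a) \<times> _) set)"
    by (auto simp: refl_on_def weighted_rel_def intro!: exI[of _ 1])
  show "sym (weighted_rel l :: (('a \<times> 'a \<times> 'a) \<times> _) set)"
  proof (rule symI, clarify)
    fix X Y Z X' Y' Z' :: 'a
    assume "((X, Y, Z), X', Y', Z') \<in> weighted_rel l"
    then obtain t where "t \<noteq> 0" "X' = t ^ (l div gcd l 3) * X" "Y' = t ^ (3 div gcd l 3) * Y" "Z' = t * Z"
      by (auto simp: weighted_rel_def)
    thus "((X', Y', Z'), X, Y, Z) \<in> weighted_rel l"
      by (auto simp: weighted_rel_def power_inverse intro!: exI[of _ "inverse t"])
  qed
  show "trans (weighted_rel l :: (('a \<times> 'a \<times> 'a) \<times> _) set)"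
  proof (rule transI, clarify)
    fix X Y Z X' Y' Z' X'' Y'' Z'' :: 'a
    assume "((X, Y, Z), X', Y', Z') \<in> weighted_rel l" "((X', Y', Z'), X'', Y'', Z'') \<in> weighted_rel l"
    then obtain t u where "t \<noteq> 0" "X' = t ^ (l div gcd l 3) * X" "Y' = t ^ (3 div gcd l 3) * Y" "Z' = t * Z"
       "u \<noteq> 0" "X'' = u ^ (l div gcd l 3) * X'" "Y'' = u ^ (3 div gcd l 3) * Y'" "Z'' = u * Z'"
      by (auto simp: weighted_rel_def)
    thus "((X, Y, Z), X'', Y'', Z'') \<in> weighted_rel l"
      by (auto simp: weighted_rel_def power_mult_distrib mult_ac intro!: exI[of _ "u * t"])
  qed
qed auto

lemma card_curve_points_aux:
  fixes a :: "'a :: finite_field"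
  assumes l: "l > 0"
  shows "card (curve_points l a) = card (affine_points l a) +
           card ({(X :: 'a, Y :: 'a, 0 :: 'a) | X Y. X \<noteq> 0 \<and> Y ^ l = X ^ 3} // weighted_rel l)"
proof -
  define m where "m = l div gcd l 3"
  have m: "m > 0" using l by (simp add: m_def div_greater_zero_iff)
  define I where "I = {(X :: 'a, Y :: 'a, 0 :: 'a) | X Y. X \<noteq> 0 \<and> Y ^ l = X ^ 3}"
  define A where "A = (\<lambda>(x, y). (x, y, 1 :: 'a)) ` affine_points l a"
  let ?R = "weighted_rel l :: (('a \<times> 'a \<times> 'a) \<times> _) set"
  note eq_iff = eq_equiv_class_iff[OF equiv_weighted_rel UNIV_I UNIV_I]
  have dvd: "m * gcd l 3 = l" "3 div gcd l 3 * gcd l 3 = 3"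
    by (simp_all add: m_def dvd_div_mult_self)
  define k where "k = 3 div gcd l 3"
  have kl: "k * l = 3 * m"
    using dvd unfolding k_def by (metis mult.assoc mult.commute)
  have sol: "curve_solutions l a = {(X, Y, Z). (X, Y, Z) \<noteq> (0, 0, 0) \<and>
     Y ^ l = (X - Z ^ m) * (X ^ 2 + a * Z ^ (2 * m))}"
    by (simp add: curve_solutions_def m_def)
  have rel: "?R = {((X, Y, Z), (X', Y', Z')).
     \<exists>t. t \<noteq> 0 \<and> X' = t ^ m * X \<and> Y' = t ^ k * Y \<and> Z' = t * Z}"
    by (simp add: weighted_rel_def m_def k_def)
  have I_sub: "I \<subseteq> curve_solutions l a"
    using m by (auto simp: I_def sol power2_eq_square power3_eq_cube power_0_left)
  have A_sub: "A \<subseteq> curve_solutions l a"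
    by (auto simp: A_def sol affine_points_def)
  have poly_id: "T ^ 3 * ((X - W) * (X ^ 2 + a * W ^ 2)) = (T * X - T * W) * ((T * X) ^ 2 + a * (T * W) ^ 2)"
    for T X W :: 'a
    by (simp add: power2_eq_square power3_eq_cube algebra_simps)
  have cases: "\<exists>v\<in>A \<union> I. (u, v) \<in> ?R" if u: "u \<in> curve_solutions l a" for u
  proof -
    obtain X Y Z where uv: "u = (X, Y, Z)" by (cases u)
    have nz: "(X, Y, Z) \<noteq> (0, 0, 0)" and eq: "Y ^ l = (X - Z ^ m) * (X ^ 2 + a * Z ^ (2 * m))"
      using u by (auto simp: sol uv)
    show ?thesis
    proof (cases "Z = 0")
      case True
      with eq m have eq': "Y ^ l = X ^ 3" by (simp add: power2_eq_square power3_eq_cube mult.assoc power_0_left)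
      have "X \<noteq> 0" using eq' nz True l by (auto simp: power_0_left)
      hence "u \<in> I" using eq' True by (auto simp: I_def uv)
      moreover have "(u, u) \<in> ?R"
        by (rule equiv_weighted_rel[THEN equivE]) (rule refl_onD[OF _ UNIV_I])
      ultimately show ?thesis by blast
    next
      case False
      let ?t = "inverse Z"
      have "(?t ^ k * Y) ^ l = ?t ^ (k * l) * Y ^ l" by (simp add: power_mult_distrib power_mult)
      also have "\<dots> = ?t ^ (m * 3) * ((X - Z ^ m) * (X ^ 2 + a * Z ^ (2 * m)))"
        by (simp add: eq kl mult.commute)
      also have "\<dots> = (?t ^ m) ^ 3 * ((X - Z ^ m) * (X ^ 2 + a * (Z ^ m) ^ 2))"
        by (simp add: mult.commute[of 2 m] power_mult)
      also have "\<dots> = (?t ^ m * X - ?t ^ m * Z ^ m) * ((?t ^ m * X) ^ 2 + a * (?t ^ m * Z ^ m) ^ 2)"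
        by (rule poly_id)
      also have "?t ^ m * Z ^ m = 1" using False by (simp flip: power_mult_distrib)
      finally have "(?t ^ k * Y) ^ l = (?t ^ m * X - 1) * ((?t ^ m * X) ^ 2 + a)" by simp
      hence "(?t ^ m * X, ?t ^ k * Y, 1) \<in> A"
        by (force simp: A_def affine_points_def)
      moreover have "(u, (?t ^ m * X, ?t ^ k * Y, 1)) \<in> ?R"
        using False by (auto simp: rel uv intro!: exI[of _ ?t])
      ultimately show ?thesis by blast
    qed
  qed
  have un: "curve_points l a = A // ?R \<union> I // ?R"
  proof
    show "curve_points l a \<subseteq> A // ?R \<union> I // ?R"
    proof
      fix P assume "P \<in> curve_points l a"
      then obtain u where u: "u \<in> curve_solutions l a" "P = ?R `` {u}"
        by (auto simp: curve_points_def elim: quotientE)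
      from cases[OF u(1)] obtain v where "v \<in> A \<union> I" "(u, v) \<in> ?R" by blast
      moreover from this have "P = ?R `` {v}" using u eq_iff by metis
      ultimately show "P \<in> A // ?R \<union> I // ?R" by (auto intro: quotientI)
    qed
    show "A // ?R \<union> I // ?R \<subseteq> curve_points l a"
      using A_sub I_sub by (auto simp: curve_points_def quotient_def)
  qed
  have disj: "A // ?R \<inter> I // ?R = {}"
  proof (rule ccontr)
    assume "A // ?R \<inter> I // ?R \<noteq> {}"
    then obtain u v where "u \<in> A" "v \<in> I" "?R `` {u} = ?R `` {v}"
      by (auto simp: quotient_def)
    hence "(u, v) \<in> ?R" using eq_iff by blast
    thus False using \<open>u \<in> A\<close> \<open>v \<in> I\<close> by (auto simp: A_def I_def rel)
  qed
  have "card (A // ?R) = card ((\<lambda>(x, y). ?R `` {(x, y, 1)}) ` affine_points l a)"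
    by (rule arg_cong[where f = card]) (auto simp: quotient_def A_def)
  also have "\<dots> = card (affine_points l a)"
  proof (rule card_image, rule inj_onI, clarify)
    fix x y x' y' assume "?R `` {(x, y, 1)} = ?R `` {(x', y', 1)}"
    hence "((x, y, 1), (x', y', 1)) \<in> ?R" using eq_iff by blast
    thus "x = x' \<and> y = y'" by (auto simp: rel)
  qed
  finally have "card (A // ?R) = card (affine_points l a)" .
  moreover have "card (curve_points l a) = card (A // ?R) + card (I // ?R)"
    unfolding un by (rule card_Un_disjoint) (use disj in auto)
  ultimately show ?thesis by (simp add: I_def)
qed

lemma card_curve_points_coprime:
  fixes a :: "'a :: finite_field"
  assumes l: "l > 0" and "\<not> 3 dvd l"
  shows "card (curve_points l a) = 1 + card (affine_points l a)"
proof -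
  let ?I = "{(X :: 'a, Y :: 'a, 0 :: 'a) | X Y. X \<noteq> 0 \<and> Y ^ l = X ^ 3}"
  let ?R = "weighted_rel l :: (('a \<times> 'a \<times> 'a) \<times> _) set"
  have cop: "coprime l 3"
    using assms(2) prime_imp_coprime[of 3 l] by (simp add: coprime_commute)
  hence g: "gcd l 3 = 1" by simp
  obtain b c where bc: "int l * b + 3 * c = 1"
    using bezout_int[of "int l" 3] cop
    by (metis coprime_iff_gcd_eq_1 coprime_int_iff mult.commute of_nat_numeral)
  have "((1, 1, 0), u) \<in> ?R" if u_in: "u \<in> ?I" for u
  proof -
    obtain X Y where u: "u = (X, Y, 0)" "X \<noteq> 0" and eq: "Y ^ l = X ^ 3" using u_in by blast
    have Y: "Y \<noteq> 0" using u eq l by (auto simp: power_0_left)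
    define t where "t = X powi b * Y powi c"
    have eq': "Y powi int l = X powi 3" using eq by simp
    have pow: "t ^ n = X powi (int n * b) * Y powi (int n * c)" for n
    proof -
      have "t ^ n = t powi int n" by simp
      also have "\<dots> = (X powi b) powi int n * (Y powi c) powi int n"
        unfolding t_def by (rule power_int_mult_distrib)
      also have "\<dots> = X powi (b * int n) * Y powi (c * int n)"
        unfolding power_int_mult ..
      finally show ?thesis unfolding mult.commute[of "int n" b] mult.commute[of "int n" c] .
    qed
    have "t ^ l = X powi (int l * b) * (Y powi int l) powi c"
      unfolding pow[of l] power_int_mult[of Y "int l" c] ..
    also have "\<dots> = X powi (int l * b + 3 * c)"
      unfolding eq' using u by (simp add: power_int_add power_int_mult)
    finally have 1: "t ^ l = X" by (simp add: bc)
    have "t ^ 3 = (X powi 3) powi b * Y powi (3 * c)"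
      using pow[of 3] unfolding of_nat_numeral power_int_mult[of X 3 b] .
    also have "\<dots> = Y powi (int l * b + 3 * c)"
      unfolding eq'[symmetric] using Y by (simp add: power_int_add power_int_mult)
    finally have 2: "t ^ 3 = Y" by (simp add: bc)
    from 1 2 u l show ?thesis
      by (auto simp: weighted_rel_def g power_0_left intro!: exI[of _ t])
  qed
  hence "?R `` {u} = ?R `` {(1, 1, 0)}" if "u \<in> ?I" for u
    using equiv_class_eq[OF equiv_weighted_rel] that by blast
  moreover have "(1, 1, 0) \<in> ?I" by auto
  ultimately have "?I // ?R = {?R `` {(1, 1, 0)}}"
    unfolding quotient_def by blast
  thus ?thesis using card_curve_points_aux[OF l, of a] by simp
qed

lemma card_roots_of_unity_le:
  assumes "n > 0"
  shows "card {z :: 'a :: finite_field. z ^ n = 1} \<le> n"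
proof -
  let ?P = "Polynomial.monom 1 n - 1 :: 'a poly"
  have deg: "degree ?P \<le> n"
    by (intro degree_diff_le) (simp_all add: degree_monom_le)
  have "coeff ?P n = 1" using assms by (simp add: coeff_1)
  hence "?P \<noteq> 0" by (metis coeff_0 zero_neq_one)
  hence "card {z. poly ?P z = 0} \<le> degree ?P" by (rule card_poly_roots_bound)
  with deg show ?thesis by (simp add: poly_monom)
qed

lemma card_curve_points_3:
  fixes a :: "'a :: finite_field"
  assumes q: "[CARD('a) = 1] (mod 3)"
  shows "card (curve_points 3 a) = 3 + card (affine_points 3 a)"
proof -
  let ?I = "{(X :: 'a, Y :: 'a, 0 :: 'a) | X Y. X \<noteq> 0 \<and> Y ^ 3 = X ^ 3}"
  let ?R = "weighted_rel 3 :: (('a \<times> 'a \<times> 'a) \<times> _) set"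
  let ?W = "{w :: 'a. w ^ 3 = 1}"
  note eq_iff = eq_equiv_class_iff[OF equiv_weighted_rel UNIV_I UNIV_I]
  have rel: "?R = {((X, Y, Z), (X', Y', Z')). \<exists>t. t \<noteq> 0 \<and> X' = t * X \<and> Y' = t * Y \<and> Z' = t * Z}"
    by (simp add: weighted_rel_def)
  have card1: "CARD('a) > 1" using card_mono[of UNIV "{0, 1 :: 'a}"] by simp
  define h where "h = (CARD('a) - 1) div 3"
  have "3 dvd CARD('a) - 1" using q card1 by (simp add: cong_altdef_nat)
  hence h: "CARD('a) = 3 * h + 1" "h > 0" using card1 by (auto simp: h_def)
  have "\<exists>x :: 'a. x \<noteq> 0 \<and> x ^ h \<noteq> 1"
  proof (rule ccontr)
    assume "\<not> ?thesis"
    hence "UNIV - {0} \<subseteq> {z :: 'a. z ^ h = 1}" by auto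
    hence "card (UNIV - {0 :: 'a}) \<le> h"
      using card_roots_of_unity_le[OF h(2), where 'a = 'a] by (meson card_mono finite le_trans)
    thus False using h by (simp add: card_Diff_singleton)
  qed
  then obtain x :: 'a where x: "x \<noteq> 0" "x ^ h \<noteq> 1" by blast
  define w where "w = x ^ h"
  have "x * x ^ (3 * h) = x" using finite_field_power_card_eq_same[of x] h by simp
  hence "x ^ (3 * h) = 1" using x by simp
  hence w: "w ^ 3 = 1" "w \<noteq> 1" using x by (simp_all add: w_def mult.commute flip: power_mult)
  have "w \<noteq> 0" using w by auto
  hence ne: "w ^ 2 \<noteq> w" using w by (simp add: power2_eq_square)
  have "w ^ 2 \<noteq> 1"
  proof
    assume "w ^ 2 = 1"
    hence "w ^ 3 = w" by (simp add: power3_eq_cube power2_eq_square)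
    with w show False by simp
  qed
  hence "card {1, w, w ^ 2} = 3" using w ne by auto
  moreover have "(w ^ 2) ^ 3 = (w ^ 3) ^ 2" by (simp flip: power_mult)
  hence "{1, w, w ^ 2} \<subseteq> ?W" using w by auto
  ultimately have "3 \<le> card ?W" by (metis card_mono finite)
  hence card_W: "card ?W = 3" using card_roots_of_unity_le[of 3, where 'a = 'a] by simp
  have "?I // ?R = (\<lambda>w. ?R `` {(1, w, 0)}) ` ?W"
  proof safe
    fix P assume "P \<in> ?I // ?R"
    then obtain X Y where XY: "X \<noteq> 0" "Y ^ 3 = X ^ 3" "P = ?R `` {(X, Y, 0)}"
      by (auto simp: quotient_def)
    have "((X, Y, 0), (1, Y / X, 0)) \<in> ?R"
      using XY by (auto simp: rel field_simps intro!: exI[of _ "inverse X"])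
    hence "P = ?R `` {(1, Y / X, 0)}" using XY eq_iff by metis
    moreover have "(Y / X) ^ 3 = 1" using XY by (simp add: power_divide)
    ultimately show "P \<in> (\<lambda>w. ?R `` {(1, w, 0)}) ` ?W" by blast
  next
    fix w :: 'a assume "w ^ 3 = 1"
    hence "(1, w, 0) \<in> ?I" by auto
    thus "?R `` {(1, w, 0)} \<in> ?I // ?R" by (rule quotientI)
  qed
  moreover have "inj_on (\<lambda>w. ?R `` {(1, w, 0)}) ?W"
  proof (rule inj_onI)
    fix v w :: 'a assume "?R `` {(1, v, 0)} = ?R `` {(1, w, 0)}"
    hence "((1, v, 0), (1, w, 0)) \<in> ?R" using eq_iff by blast
    thus "v = w" by (auto simp: rel)
  qed
  ultimately have "card (?I // ?R) = 3" using card_W by (simp add: card_image)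
  thus ?thesis using card_curve_points_aux[of 3 a] by simp
qed

end

(*
Counting the l-th roots of f(x) = (x - 1)(x^2 + lambda) with the powers of S gives
N = q + sum_{0 < i < l} sum_x S^i(f x), so it suffices to identify each inner sum.  Write
t = 1 + lambda and S^i = T^2.  The functions t |-> sum_x T^(-2)((x - 1)(x^2 + t - 1)) and
t |-> 2F1(T^3 phi, T^3; T^4 | t) are compared through their Mellin transforms over the group of
multiplicative characters X.  The transform of the hypergeometric function is a product of two
Jacobi sums by definition.  For the character sum, x = u + 1 and the substitution a = u^2 v,
b = 2 u v in a triple sum turn it into the product G(X^-1) G(T^-4 X^-1) G(T^6 X^2) of Gauss sums,
up to a factor.  The two transforms agree by the quadratic Hasse-Davenport relation.
*)

theory Submission
  imports "HOL-Algebra.Multiplicative_Group" Defs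
begin

text \<open>In the transform of the hypergeometric function the two Jacobi sums have character
  products \<open>T ^ 3 * \<phi>\<close> and \<open>inverse T\<close> for every X. Hence their Gauss
  sum formulas need no case distinction on X, only that these two characters are nontrivial. Here
  \<open>\<not> 3 dvd l\<close> enters: \<open>T ^ 3 * \<phi> = 1\<close> would force S^(3i) = 1.
  The quotient of Jacobi sums in the statement is the constant that turns the remaining denominator
  G(T^3 \<phi>) G(T^-1) into G(\<phi>) G(T^2). Hasse-Davenport cancels the first factor; the second
  is the Gauss sum by which the character sum is multiplied so that the values of T^-2 can be
  expanded in an additive character. For l = 3 the same identity is applied to T = S^i itself, since
  then T^-2 = T and T^3 = 1, and the quotient becomes 1. All characters vanish at 0, so a transform
  determines a function only at nonzero arguments; good reduction makes t nonzero.\<close>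

section \<open>Cyclicity of the multiplicative group, and separation of its elements by
  characters\<close>

lemma finite_field_generator:
  "\<exists>g :: 'a :: finite_field. \<forall>x. x \<noteq> 0 \<longrightarrow> (\<exists>k. x = g ^ k)"
proof -
  \<comment> \<open>The type-class field is repackaged as a record so that the cyclicity theorem for
    \<open>mult_of\<close> applies.\<close>
  define R :: "'a ring" where
    "R = \<lparr>carrier = UNIV, monoid.mult = (*), one = 1, ring.zero = 0, add = (+)\<rparr>"
  have "\<exists>y. x + y = 0" for x :: 'a
    using add.right_inverse by blast
  moreover have "\<exists>y. x * y = 1" if "x \<noteq> 0" for x :: 'a
    using that by (intro exI[of _ "inverse x"]) simp
  ultimately interpret R: field R
    unfolding R_def using add.right_inverse
    by unfold_locales (auto simp: algebra_simps Units_def)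
  have pow: "a [^]\<^bsub>R\<^esub> (k :: nat) = a ^ k" for a k
    by (induction k) (simp_all add: R_def nat_pow_def mult.commute)
  obtain g where "carrier (mult_of R) = {g [^]\<^bsub>R\<^esub> k | k :: nat. k \<in> UNIV}"
    using R.finite_field_mult_group_has_gen by (auto simp: R_def)
  hence "UNIV - {0} = {g ^ k | k :: nat. True}" by (simp add: pow) (simp add: R_def)
  thus ?thesis by blast
qed

lemma finite_field_card_gt_1: "CARD('a :: finite_field) > 1"
  using card_mono[of UNIV "{0, 1 :: 'a}"] by simp

lemma finite_field_power_card_minus_1:
  fixes x :: "'a :: finite_field"
  assumes "x \<noteq> 0"
  shows "x ^ (CARD('a) - 1) = 1"
proof -
  have "x * x ^ (CARD('a) - 1) = x ^ CARD('a)"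
    using finite_field_card_gt_1[where 'a = 'a] by (cases "CARD('a)") simp_all
  thus ?thesis using assms finite_field_power_card_eq_same[of x] by simp
qed

text \<open>Sending a generator to a primitive root of unity of order q - 1 gives a character that
  is injective on nonzero elements.\<close>

lemma mchar_separates:
  fixes x :: "'a :: finite_field"
  assumes "x \<noteq> 0" "x \<noteq> 1"
  obtains \<chi> :: "'a mchar" where "mchar_apply \<chi> x \<noteq> 1"
proof -
  define n where "n = CARD('a) - 1"
  have n: "n > 0" using finite_field_card_gt_1[where 'a = 'a] by (simp add: n_def)
  obtain g :: 'a where g: "\<And>x. x \<noteq> 0 \<Longrightarrow> \<exists>k. x = g ^ k"
    using finite_field_generator by blast
  have "g \<noteq> 0"
  proof
    assume "g = 0"
    obtain k where "x = g ^ k" using g assms by blast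
    thus False using \<open>g = 0\<close> assms by (cases k) auto
  qed
  hence gn: "g ^ n = 1" unfolding n_def by (rule finite_field_power_card_minus_1)
  have gmod: "g ^ k = g ^ (k mod n)" for k
  proof -
    have "g ^ k = g ^ (n * (k div n) + k mod n)" by simp
    also have "\<dots> = g ^ (k mod n)" by (simp only: power_add power_mult gn) simp
    finally show ?thesis .
  qed
  have "(\<lambda>k. g ^ k) ` {..<n} = UNIV - {0}"
  proof (intro equalityI subsetI)
    fix y :: 'a assume "y \<in> UNIV - {0}"
    then obtain k where "y = g ^ k" using g by blast
    thus "y \<in> (\<lambda>k. g ^ k) ` {..<n}" using gmod[of k] n by auto
  qed (use \<open>g \<noteq> 0\<close> in auto)
  \<comment> \<open>The powers below n already cover n elements, so they are distinct; this is the
    exact order of g.\<close>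
  hence inj: "inj_on (\<lambda>k. g ^ k) {..<n}"
    by (intro eq_card_imp_inj_on) (simp_all add: n_def)
  define c where "c = (\<lambda>k. cis (2 * pi * real k / real n))"
  have cpow: "c k = c 1 ^ k" for k
    by (simp add: c_def DeMoivre mult_ac)
  have "c n = 1" using n by (simp add: c_def)
  hence c1n: "c 1 ^ n = 1" using cpow[of n] by simp
  have cmod: "c k = c (k mod n)" for k
  proof -
    have "c k = c 1 ^ (n * (k div n) + k mod n)" unfolding cpow[of k] by simp
    also have "\<dots> = c 1 ^ (k mod n)" by (simp only: power_add power_mult c1n) simp
    also have "\<dots> = c (k mod n)" by (simp only: cpow[of "k mod n"])
    finally show ?thesis .
  qed
  have cg: "c j = c k" if "g ^ j = g ^ k" for j k
  proof -
    have "j mod n = k mod n"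
      by (rule inj_onD[OF inj]) (use that gmod[of j] gmod[of k] n in auto)
    thus ?thesis using cmod[of j] cmod[of k] by simp
  qed
  \<comment> \<open>By \<open>cg\<close> the value does not depend on which discrete logarithm is
    chosen.\<close>
  define f where "f = (\<lambda>y. if y = 0 then 0 else c (SOME k. y = g ^ k))"
  have f: "f (g ^ k) = c k" for k
  proof -
    have "g ^ k = g ^ (SOME j. g ^ k = g ^ j)" by (rule someI) (rule refl)
    from cg[OF this] show ?thesis using \<open>g \<noteq> 0\<close> by (simp add: f_def)
  qed
  have "f 0 = 0" by (simp add: f_def)
  moreover have "f 1 = 1" using f[of 0] by (simp add: c_def)
  moreover have "f (y * z) = f y * f z" for y z
  proof (cases "y = 0 \<or> z = 0")
    case False
    then obtain j k where "y = g ^ j" "z = g ^ k" using g by blast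
    thus ?thesis using f[of "j + k"] cpow[of "j + k"] cpow[of j] cpow[of k]
      by (simp add: f power_add)
  qed (auto simp: f_def)
  ultimately have app: "mchar_apply (Abs_mchar f) = f"
    by (intro Abs_mchar_inverse) auto
  obtain k where k: "x = g ^ k" using g assms by blast
  have "f x \<noteq> 1"
  proof
    assume "f x = 1"
    hence "c (k mod n) = c 0" using f[of k] k cmod[of k] by (simp add: c_def)
    moreover have "inj_on c {..<n}"
      using bij_betw_roots_unity[OF n] by (simp add: c_def bij_betw_def)
    ultimately have "k mod n = 0" using n by (auto dest: inj_onD)
    thus False using k gmod[of k] assms by simp
  qed
  with app that[of "Abs_mchar f"] show thesis by simp
qed

section \<open>The character group and its orthogonality relations\<close>

lemma mchar_eqI: "(\<And>x. x \<noteq> 0 \<Longrightarrow> mchar_apply A x = mchar_apply B x) \<Longrightarrow> A = B"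
  by (metis ext mchar_apply_0 mchar_apply_inject)

lemma mchar_inverse_mult [simp]: "inverse A * A = (1 :: 'a :: field mchar)"
  by (simp add: mult.commute)

lemma mchar_inverse_unique: "A * B = (1 :: 'a :: field mchar) \<Longrightarrow> inverse A = B"
  by (metis mchar_inverse_mult mult.assoc mult.right_neutral mult_1)

lemma mchar_inverse_inverse [simp]: "inverse (inverse A) = (A :: 'a :: field mchar)"
  by (rule mchar_inverse_unique) simp

lemma mchar_inverse_mult_distrib: "inverse (A * B) = inverse A * inverse (B :: 'a :: field mchar)"
  by (rule mchar_eqI) simp

lemma mchar_inverse_one [simp]: "inverse 1 = (1 :: 'a :: field mchar)"
  by (rule mchar_inverse_unique) simp

lemma mchar_inverse_power: "inverse A ^ n = inverse (A ^ n :: 'a :: field mchar)"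
  by (induction n) (simp_all add: mchar_inverse_mult_distrib)

lemma mchar_inverse_eq_1_iff [simp]: "inverse A = 1 \<longleftrightarrow> A = (1 :: 'a :: field mchar)"
  by (metis mchar_inverse_inverse mchar_inverse_one)

lemma mchar_power_apply: "mchar_apply (A ^ n) x = (if x = 0 then 0 else mchar_apply A x ^ n)"
  by (induction n) (simp_all add: mchar_one_apply)

lemma mchar_apply_inverse: "mchar_apply A (inverse x) = inverse (mchar_apply A x)"
  by (metis inverse_unique inverse_zero mchar_apply_0 mchar_apply_1 mchar_apply_mult right_inverse)

lemma mchar_apply_divide: "mchar_apply A (x / y) = mchar_apply A x / mchar_apply A y"
  by (simp add: divide_inverse mchar_apply_mult mchar_apply_inverse)

lemma sum_UNIV_mult_field:
  fixes c :: "'a :: {field, finite}"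
  assumes "c \<noteq> 0"
  shows "(\<Sum>x\<in>UNIV. f (c * x)) = (\<Sum>x\<in>UNIV. f x)"
  by (rule sum.reindex_bij_witness[of _ "\<lambda>x. x / c" "\<lambda>x. c * x"]) (use assms in auto)

lemma sum_mchar_apply:
  fixes A :: "'a :: finite_field mchar"
  shows "(\<Sum>x\<in>UNIV. mchar_apply A x) = (if A = 1 then of_nat (CARD('a) - 1) else 0)"
proof (cases "A = 1")
  case True
  have "(\<Sum>x\<in>UNIV. mchar_apply A x) = (\<Sum>x\<in>UNIV - {0 :: 'a}. 1)"
    unfolding True by (rule sum.mono_neutral_cong_right) (auto simp: mchar_one_apply)
  thus ?thesis using True by simp
next
  case False
  then obtain c where c: "c \<noteq> 0" "mchar_apply A c \<noteq> 1"
    using mchar_eqI[of A 1] by (auto simp: mchar_one_apply)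
  have "(\<Sum>x\<in>UNIV. mchar_apply A x) = mchar_apply A c * (\<Sum>x\<in>UNIV. mchar_apply A x)"
    using sum_UNIV_mult_field[OF c(1), of "mchar_apply A"]
    by (simp add: mchar_apply_mult sum_distrib_left)
  thus ?thesis using c False by simp
qed

lemma sum_mchar_mult:
  fixes B :: "'a :: finite_field mchar"
  shows "(\<Sum>\<chi>\<in>UNIV. f (B * \<chi>)) = (\<Sum>\<chi>\<in>UNIV. f \<chi>)"
  by (rule sum.reindex_bij_witness[of _ "\<lambda>\<chi>. inverse B * \<chi>" "\<lambda>\<chi>. B * \<chi>"])
     (simp_all flip: mult.assoc)

lemma sum_over_mchars:
  fixes t :: "'a :: finite_field"
  shows "(\<Sum>\<chi>\<in>UNIV. mchar_apply \<chi> t) = (if t = 1 then of_nat (CARD('a) - 1) else 0)"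
proof -
  have *: "(\<Sum>\<chi>\<in>UNIV. mchar_apply \<chi> t) = 0" if t: "t \<noteq> 1" for t :: 'a
  proof (cases "t = 0")
    case False
    then obtain B where B: "mchar_apply B t \<noteq> 1" using mchar_separates[of t] t by blast
    have "(\<Sum>\<chi>\<in>UNIV. mchar_apply \<chi> t) = mchar_apply B t * (\<Sum>\<chi>\<in>UNIV. mchar_apply \<chi> t)"
      using sum_mchar_mult[of "\<lambda>\<chi>. mchar_apply \<chi> t" B] by (simp add: sum_distrib_left)
    thus ?thesis using B by simp
  qed simp
  \<comment> \<open>The value at 1 is the number of characters. Since every other t contributes 0,
    it equals the sum over all t, which after exchanging the sums only sees the trivial
    character.\<close>
  have "(\<Sum>\<chi>\<in>UNIV. mchar_apply \<chi> (1 :: 'a)) = (\<Sum>t\<in>{1 :: 'a}. \<Sum>\<chi>\<in>UNIV. mchar_apply \<chi> t)"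
    by simp
  also have "\<dots> = (\<Sum>t\<in>UNIV. \<Sum>\<chi>\<in>UNIV. mchar_apply \<chi> (t :: 'a))"
    by (rule sum.mono_neutral_left) (use * in auto)
  also have "\<dots> = (\<Sum>\<chi>\<in>UNIV. \<Sum>t\<in>UNIV. mchar_apply \<chi> (t :: 'a))"
    by (rule sum.swap)
  also have "\<dots> = (\<Sum>\<chi>\<in>(UNIV :: 'a mchar set). if \<chi> = 1 then of_nat (CARD('a) - 1) else 0)"
    by (simp only: sum_mchar_apply)
  also have "\<dots> = of_nat (CARD('a) - 1)" by simp
  finally show ?thesis using * by auto
qed

section \<open>Counting l-th roots by characters\<close>

lemma sum_powers_mchar:
  fixes S :: "'a :: finite_field mchar"
  assumes "S ^ l = 1" "c \<noteq> 0"
  shows "(\<Sum>i<l. mchar_apply (S ^ i) c) = (if mchar_apply S c = 1 then of_nat l else 0)"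
proof (cases "mchar_apply S c = 1")
  case True
  thus ?thesis using assms by (simp add: mchar_power_apply)
next
  case False
  have "mchar_apply S c ^ l = 1"
    using assms mchar_power_apply[of S l c] by (simp add: mchar_one_apply)
  thus ?thesis using False assms by (simp add: mchar_power_apply geometric_sum)
qed

text \<open>
  No generator is needed: the left side is at most the right side for every \<open>c\<close>, and both sides
  have the same sum over all nonzero \<open>c\<close>.
\<close>

lemma card_power_eq:
  fixes S :: "'a :: finite_field mchar"
  assumes "mchar_has_order S l" "c \<noteq> 0"
  shows "of_nat (card {y. y ^ l = c}) = (\<Sum>i<l. mchar_apply (S ^ i) c)"
proof -
  have l: "l > 0" and Sl: "S ^ l = 1" and ord: "\<And>k. 0 < k \<Longrightarrow> k < l \<Longrightarrow> S ^ k \<noteq> 1"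
    using assms by (auto simp: mchar_has_order_def)
  define r where "r = (\<lambda>c. if mchar_apply S c = 1 then l else 0)"
  have r: "of_nat (r c) = (\<Sum>i<l. mchar_apply (S ^ i) c)" if "c \<noteq> 0" for c
    using sum_powers_mchar[OF Sl that] by (simp add: r_def)
  have le: "card {y. y ^ l = c} \<le> r c" if c: "c \<noteq> 0" for c
  proof (cases "\<exists>y. y ^ l = c")
    case True
    then obtain d where d: "d ^ l = c" by blast
    hence "d \<noteq> 0" using c l by (auto simp: power_0_left)
    have "mchar_apply S c = 1"
      unfolding d[symmetric] mchar_apply_power
      using mchar_power_apply[of S l d] \<open>d \<noteq> 0\<close> by (simp add: Sl mchar_one_apply)
    hence "r c = l" by (simp add: r_def)
    have "{y. y ^ l = c} \<subseteq> (\<lambda>w. d * w) ` {w. w ^ l = 1}"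
    proof
      fix y assume "y \<in> {y. y ^ l = c}"
      hence "(y / d) ^ l = 1" using d c by (simp add: power_divide)
      thus "y \<in> (\<lambda>w. d * w) ` {w. w ^ l = 1}"
        using \<open>d \<noteq> 0\<close> by (intro image_eqI[of _ _ "y / d"]) auto
    qed
    hence "card {y. y ^ l = c} \<le> card ((\<lambda>w. d * w) ` {w. w ^ l = 1})"
      by (rule card_mono[rotated]) simp
    also have "\<dots> \<le> card {w :: 'a. w ^ l = 1}" by (rule card_image_le) simp
    also have "\<dots> \<le> l" by (rule card_roots_of_unity_le[OF l])
    finally show ?thesis using \<open>r c = l\<close> by simp
  next
    case False
    hence "{y. y ^ l = c} = {}" by blast
    thus ?thesis by simp
  qed
  have "(\<Sum>c\<in>UNIV - {0}. card {y :: 'a. y ^ l = c}) = card (\<Union>c\<in>UNIV - {0}. {y :: 'a. y ^ l = c})"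
    by (rule card_UN_disjoint[symmetric]) auto
  also have "(\<Union>c\<in>UNIV - {0}. {y :: 'a. y ^ l = c}) = UNIV - {0}"
    using l by (auto simp: power_0_left)
  finally have 1: "(\<Sum>c\<in>UNIV - {0}. card {y :: 'a. y ^ l = c}) = CARD('a) - 1" by simp
  have "of_nat (\<Sum>c\<in>UNIV - {0}. r c) = (\<Sum>c\<in>UNIV - {0}. \<Sum>i<l. mchar_apply (S ^ i) c)"
    by (simp add: r)
  also have "\<dots> = (\<Sum>c\<in>UNIV. \<Sum>i<l. mchar_apply (S ^ i) c)"
    by (rule sum.mono_neutral_left) auto
  also have "\<dots> = (\<Sum>i<l. \<Sum>c\<in>UNIV. mchar_apply (S ^ i) c)" by (rule sum.swap)
  also have "\<dots> = (\<Sum>i<l. if i = 0 then of_nat (CARD('a) - 1) else 0)"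
    by (rule sum.cong) (use ord in \<open>auto simp: sum_mchar_apply\<close>)
  also have "\<dots> = of_nat (CARD('a) - 1)" using l by simp
  finally have 2: "(\<Sum>c\<in>UNIV - {0}. r c) = CARD('a) - 1" by (simp only: of_nat_eq_iff)
  have "card {y. y ^ l = c} = r c"
    by (rule sum_mono_inv[where I = "UNIV - {0}"]) (use 1 2 le assms in auto)
  thus ?thesis using r[OF assms(2)] by simp
qed

section \<open>Additive characters of a finite field\<close>

lemma sum_UNIV_add_group:
  fixes c :: "'a :: {ab_group_add, finite}"
  shows "(\<Sum>x\<in>UNIV. f (c + x)) = (\<Sum>x\<in>UNIV. f x)"
  by (rule sum.reindex_bij_witness[of _ "\<lambda>x. x - c" "\<lambda>x. c + x"]) auto

text \<open>The theorem involves no additive character; one is fixed only to form Gauss sums, and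
  the main proof interprets the locale with any that exists.\<close>

locale additive_character =
  fixes \<psi> :: "'a :: finite_field \<Rightarrow> complex"
  assumes psi_0 [simp]: "\<psi> 0 = 1"
    and psi_add: "\<psi> (x + y) = \<psi> x * \<psi> y"
    and psi_nontrivial: "\<exists>x. \<psi> x \<noteq> 1"

text \<open>Translation by 1 permutes the field, so summing all elements before and after shows that
  q is 0 in it.\<close>

lemma CHAR_eq_if_card_prime_power:
  assumes "prime p" "CARD('a :: finite_field) = p ^ e"
  shows "CHAR('a) = p"
proof -
  have "(\<Sum>x\<in>UNIV. 1 + x :: 'a) = (\<Sum>x\<in>UNIV. x)" by (rule sum_UNIV_add_group)
  hence "of_nat (CARD('a)) = (0 :: 'a)" by (simp add: sum.distrib)
  hence "CHAR('a) dvd p ^ e" using assms(2) of_nat_eq_0_iff_char_dvd by metis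
  hence "CHAR('a) dvd p" using prime_dvd_power[OF CHAR_prime] by blast
  thus ?thesis using assms(1) CHAR_prime[where 'a = 'a] primes_dvd_imp_eq by blast
qed

text \<open>The character is \<open>x \<mapsto> exp (2 \<pi> i Tr(x) / p)\<close>, where \<open>Tr\<close> is the trace to the prime field.\<close>

lemma exists_additive_character:
  assumes p: "prime p" and card: "CARD('a :: finite_field) = p ^ e"
  shows "\<exists>\<psi> :: 'a \<Rightarrow> complex. additive_character \<psi>"
proof -
  have char: "CHAR('a) = p" by (rule CHAR_eq_if_card_prime_power[OF assms])
  have p1: "p > 1" using p by (rule prime_gt_1_nat)
  have e: "e > 0" using card finite_field_card_gt_1[where 'a = 'a] by (cases e) auto
  have of_nat_eq: "(of_nat j :: 'a) = of_nat k \<longleftrightarrow> [j = k] (mod p)" for j k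
    using of_nat_eq_iff_cong_CHAR[where 'a = 'a] by (simp add: char)
  define Tr where "Tr = (\<lambda>x :: 'a. \<Sum>i<e. x ^ (p ^ i))"
  have Tr_add: "Tr (x + y) = Tr x + Tr y" for x y
  proof -
    have "(x + y) ^ (p ^ i) = x ^ (p ^ i) + y ^ (p ^ i)" for i
      using freshmans_dream'[of "p ^ i" i x y] p by (simp add: char)
    thus ?thesis by (simp add: Tr_def sum.distrib)
  qed
  have Tr_0: "Tr 0 = 0" using p1 by (simp add: Tr_def power_0_left)
  \<comment> \<open>Frobenius shifts the summands cyclically, the cycle closing because x^q = x. So
    the trace lies in the prime field.\<close>
  have Tr_pow: "Tr x ^ p = Tr x" for x
  proof -
    have "Tr x ^ p = (\<Sum>i<e. (x ^ (p ^ i)) ^ p)"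
      unfolding Tr_def by (rule freshmans_dream_sum) (simp_all add: char p)
    also have "\<dots> = (\<Sum>i<e. x ^ (p ^ Suc i))" by (simp only: power_Suc2 power_mult)
    also have "\<dots> = (\<Sum>i<Suc e. x ^ (p ^ i)) - x" by (subst sum.lessThan_Suc_shift) simp
    also have "\<dots> = Tr x + x ^ (p ^ e) - x" by (simp add: Tr_def)
    also have "x ^ (p ^ e) = x" using finite_field_power_card_eq_same[of x] card by simp
    finally show ?thesis by simp
  qed
  have roots: "{t :: 'a. t ^ p = t} = of_nat ` {..<p}"
  proof (rule sym, rule card_seteq)
    show "(of_nat ` {..<p} :: 'a set) \<subseteq> {t. t ^ p = t}"
    proof (rule image_subsetI)
      fix k show "of_nat k \<in> {t :: 'a. t ^ p = t}"
      proof (induction k)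
        case (Suc k)
        have "(1 + of_nat k :: 'a) ^ p = 1 ^ p + of_nat k ^ p"
          by (rule freshmans_dream) (simp_all add: char p)
        with Suc show ?case by simp
      qed (use p1 in \<open>simp add: power_0_left\<close>)
    qed
    have "inj_on (of_nat :: nat \<Rightarrow> 'a) {..<p}"
      by (rule inj_onI) (auto simp: of_nat_eq cong_def)
    hence "card (of_nat ` {..<p} :: 'a set) = p" by (simp add: card_image)
    moreover have "card {t :: 'a. t ^ p = t} \<le> p"
    proof -
      let ?P = "Polynomial.monom 1 p - Polynomial.monom 1 1 :: 'a poly"
      have deg: "Polynomial.degree ?P \<le> p"
        by (intro degree_diff_le order.trans[OF degree_monom_le]) (use p1 in auto)
      have "poly.coeff ?P p = 1" using p1 by (simp add: coeff_monom)
      hence "?P \<noteq> 0" by (metis coeff_0 zero_neq_one)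
      hence "card {t. poly ?P t = 0} \<le> Polynomial.degree ?P" by (rule card_poly_roots_bound)
      with deg show ?thesis by (simp add: poly_monom)
    qed
    ultimately show "card {t :: 'a. t ^ p = t} \<le> card (of_nat ` {..<p} :: 'a set)" by simp
  qed simp
  \<comment> \<open>As a polynomial the trace has linear coefficient 1 and degree at most p^(e-1) <
    q, so it cannot vanish on the whole field.\<close>
  have "\<exists>x. Tr x \<noteq> 0"
  proof (rule ccontr)
    assume *: "\<nexists>x. Tr x \<noteq> 0"
    let ?P = "\<Sum>i<e. Polynomial.monom 1 (p ^ i) :: 'a poly"
    have "Polynomial.degree ?P \<le> p ^ (e - 1)"
      by (intro degree_sum_le order.trans[OF degree_monom_le] power_increasing) (use p1 in auto)
    moreover have "poly.coeff ?P 1 = (\<Sum>i<e. if i = 0 then 1 else 0)"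
      unfolding coeff_sum by (rule sum.cong) (use p1 in \<open>auto simp: coeff_monom\<close>)
    hence "poly.coeff ?P 1 = 1" using e by simp
    hence "?P \<noteq> 0" by (metis coeff_0 zero_neq_one)
    hence "card {t. poly ?P t = 0} \<le> Polynomial.degree ?P" by (rule card_poly_roots_bound)
    moreover have "{t. poly ?P t = 0} = UNIV"
      using * by (simp add: poly_sum poly_monom Tr_def)
    ultimately have "p ^ e \<le> p ^ (e - 1)" by (simp add: card)
    moreover have "p ^ (e - 1) < p ^ e" using p1 e by (intro power_strict_increasing) auto
    ultimately show False by simp
  qed
  then obtain x0 where x0: "Tr x0 \<noteq> 0" by blast
  define c where "c = (\<lambda>k. cis (2 * pi * real k / real p))"
  have c_add: "c (j + k) = c j * c k" for j k
    by (simp add: c_def cis_mult add_divide_distrib distrib_left)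
  have c_mult_p: "c (p * k) = 1" for k
  proof -
    have "2 * pi * real (p * k) / real p = 2 * pi * real k" using p1 by simp
    thus ?thesis using cis_multiple_2pi[of "real k"] by (simp only: c_def) simp
  qed
  have c_mod: "c k = c (k mod p)" for k
    using c_add[of "p * (k div p)" "k mod p"] by (simp add: c_mult_p)
  have c_cong: "c j = c k" if "(of_nat j :: 'a) = of_nat k" for j k
    using that c_mod[of j] c_mod[of k] by (simp add: of_nat_eq cong_def)
  define idx where "idx = (\<lambda>t :: 'a. SOME k. t = of_nat k)"
  have idx: "of_nat (idx (Tr x)) = Tr x" for x
  proof -
    have "Tr x \<in> of_nat ` {..<p}" using Tr_pow roots by blast
    hence "\<exists>k. Tr x = of_nat k" by blast
    hence "Tr x = of_nat (idx (Tr x))" unfolding idx_def by (rule someI_ex)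
    thus ?thesis by simp
  qed
  have "additive_character (\<lambda>x. c (idx (Tr x)))"
  proof
    show "c (idx (Tr 0)) = 1"
      using c_cong[of "idx (Tr 0)" 0] idx[of 0] by (simp add: Tr_0) (simp add: c_def)
    show "c (idx (Tr (x + y))) = c (idx (Tr x)) * c (idx (Tr y))" for x y
      unfolding c_add[symmetric] by (rule c_cong) (simp only: idx of_nat_add, rule Tr_add)
    have "c (idx (Tr x0)) \<noteq> 1"
    proof
      assume "c (idx (Tr x0)) = 1"
      hence "c (idx (Tr x0) mod p) = c 0" using c_mod[of "idx (Tr x0)"] by (simp add: c_def)
      moreover have "inj_on c {..<p}"
        using bij_betw_roots_unity[of p] p1 by (simp add: c_def bij_betw_def)
      ultimately have "idx (Tr x0) mod p = 0" using p1 by (auto dest: inj_onD)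
      hence "(of_nat (idx (Tr x0)) :: 'a) = of_nat 0" unfolding of_nat_eq by (simp add: cong_def)
      thus False using x0 idx[of x0] by simp
    qed
    thus "\<exists>x. c (idx (Tr x)) \<noteq> 1" by blast
  qed
  thus ?thesis by blast
qed

section \<open>The quadratic character and Jacobi sums\<close>

lemma square_not_surj:
  assumes "(2 :: 'a :: finite_field) \<noteq> 0"
  shows "\<exists>x :: 'a. \<nexists>z. x = z ^ 2"
proof (rule ccontr)
  assume "\<not> ?thesis"
  hence "surj (\<lambda>z :: 'a. z ^ 2)" by (force simp: surj_def)
  hence "inj (\<lambda>z :: 'a. z ^ 2)" by (simp add: finite_UNIV_surj_inj)
  hence "(1 :: 'a) = -1" by (rule injD) simp
  hence "(2 :: 'a) = 0" by (metis add.right_inverse one_add_one)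
  with assms show False by simp
qed

lemma quadratic_mchar_apply:
  "mchar_apply quadratic_mchar x = (if x = 0 then 0 else if \<exists>z. x = z ^ 2 then 1 else -1)"
  by transfer simp

lemma quadratic_mchar_neq_1:
  assumes "(2 :: 'a :: finite_field) \<noteq> 0"
  shows "quadratic_mchar \<noteq> (1 :: 'a mchar)"
proof
  assume *: "quadratic_mchar = (1 :: 'a mchar)"
  obtain x :: 'a where x: "\<nexists>z. x = z ^ 2" using square_not_surj[OF assms] by blast
  hence "x \<noteq> 0" by force
  thus False using x arg_cong[OF *, of "\<lambda>\<chi>. mchar_apply \<chi> x"]
    by (simp add: quadratic_mchar_apply mchar_one_apply)
qed

lemma quadratic_mchar_square [simp]: "quadratic_mchar * quadratic_mchar = (1 :: 'a :: finite_field mchar)"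
  by (rule mchar_eqI) (simp add: quadratic_mchar_apply mchar_one_apply)

lemma inverse_quadratic_mchar [simp]: "inverse quadratic_mchar = (quadratic_mchar :: 'a :: finite_field mchar)"
  by (rule mchar_inverse_unique) simp

text \<open>Such an A has values 1 and -1 on nonzero elements, is 1 on squares, and is -1 at some b,
  necessarily a nonsquare. Any other nonsquare times b is a square, which fixes A there too.\<close>

lemma mchar_square_eq_1:
  fixes A :: "'a :: finite_field mchar"
  assumes "A * A = 1" "A \<noteq> 1"
  shows "A = quadratic_mchar"
proof -
  have sq: "mchar_apply A x * mchar_apply A x = 1" if "x \<noteq> 0" for x
    using that arg_cong[OF assms(1), of "\<lambda>\<chi>. mchar_apply \<chi> x"] by (simp add: mchar_one_apply)
  obtain b where b: "b \<noteq> 0" "mchar_apply A b \<noteq> 1"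
    using assms(2) mchar_eqI[of A 1] by (auto simp: mchar_one_apply)
  hence b': "mchar_apply A b = -1" using sq[of b] by (simp add: square_eq_1_iff)
  have nb: "\<nexists>z. b = z ^ 2"
  proof
    assume "\<exists>z. b = z ^ 2"
    then obtain z where "b = z * z" by (auto simp: power2_eq_square)
    thus False using b sq[of z] by (auto simp: mchar_apply_mult)
  qed
  show ?thesis
  proof (rule mchar_eqI)
    fix x :: 'a assume x: "x \<noteq> 0"
    show "mchar_apply A x = mchar_apply quadratic_mchar x"
    proof (cases "\<exists>z. x = z ^ 2")
      case True
      then obtain z where "x = z * z" by (auto simp: power2_eq_square)
      thus ?thesis using x True sq[of z] by (auto simp: mchar_apply_mult quadratic_mchar_apply)
    next
      case False
      then obtain z where z: "x * b = z * z"
        using nonsquare_mult_nonsquare[OF False nb] by (auto simp: power2_eq_square)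
      hence "z \<noteq> 0" using x b by auto
      have "mchar_apply A x * mchar_apply A b = 1"
        using sq[OF \<open>z \<noteq> 0\<close>] z by (metis mchar_apply_mult)
      thus ?thesis using x False b' by (simp add: quadratic_mchar_apply minus_equation_iff)
    qed
  qed
qed

lemma card_square_roots:
  fixes c :: "'a :: finite_field"
  assumes "(2 :: 'a) \<noteq> 0"
  shows "of_nat (card {y. y ^ 2 = c}) = 1 + mchar_apply quadratic_mchar c"
proof (cases "c = 0")
  case False
  have "quadratic_mchar ^ k \<noteq> (1 :: 'a mchar)" if "0 < k" "k < 2" for k
  proof -
    have "k = 1" using that by simp
    thus ?thesis using quadratic_mchar_neq_1[OF assms] by simp
  qed
  hence "mchar_has_order (quadratic_mchar :: 'a mchar) 2"
    by (simp add: mchar_has_order_def power2_eq_square)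
  from card_power_eq[OF this False] show ?thesis
    by (simp add: numeral_2_eq_2 mchar_one_apply False)
qed simp

lemma four_nonzero:
  assumes "(2 :: 'a :: finite_field) \<noteq> 0"
  shows "(4 :: 'a) \<noteq> 0"
proof -
  have "(4 :: 'a) = 2 * 2" by simp
  thus ?thesis using assms by (metis mult_eq_0_iff)
qed

lemma quadratic_mchar_4:
  assumes "(2 :: 'a :: finite_field) \<noteq> 0"
  shows "mchar_apply quadratic_mchar (4 :: 'a) = 1"
proof -
  have "(4 :: 'a) = 2 ^ 2" by simp
  thus ?thesis using four_nonzero[OF assms] by (metis quadratic_mchar_apply)
qed

lemma jacobi_sum_commute: "jacobi_sum A B = jacobi_sum B A"
  unfolding jacobi_sum_def
  by (rule sum.reindex_bij_witness[of _ "\<lambda>x. 1 - x" "\<lambda>x. 1 - x"]) (auto simp: mult.commute)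

text \<open>Group the terms A(x (1 - x)) by n = x (1 - x). Completing the square with y = 1 - 2x
  gives y^2 = 1 - 4n, so the fibre has 1 + \<phi>(1 - 4n) elements. Rescaling n by 4 produces the
  factor A(4)^-1, which survives into Hasse-Davenport.\<close>

lemma jacobi_sum_same:
  fixes A :: "'a :: finite_field mchar"
  assumes two: "(2 :: 'a) \<noteq> 0" and A: "A \<noteq> 1"
  shows "jacobi_sum A A = inverse (mchar_apply A 4) * jacobi_sum A quadratic_mchar"
proof -
  have four: "(4 :: 'a) \<noteq> 0" by (rule four_nonzero[OF two])
  have card: "of_nat (card {x. x * (1 - x) = n}) = 1 + mchar_apply quadratic_mchar (1 - 4 * n)" for n :: 'a
  proof -
    have "bij_betw (\<lambda>x. 1 - 2 * x) {x. x * (1 - x) = n} {y. y ^ 2 = 1 - 4 * n}"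
    proof (rule bij_betw_byWitness[where f' = "\<lambda>y. (1 - y) / 2"])
      show "(\<lambda>x. 1 - 2 * x) ` {x. x * (1 - x) = n} \<subseteq> {y. y ^ 2 = 1 - 4 * n}"
      proof clarify
        fix x :: 'a
        show "(1 - 2 * x) ^ 2 = 1 - 4 * (x * (1 - x))"
          by (simp add: power2_eq_square algebra_simps)
      qed
      show "(\<lambda>y. (1 - y) / 2) ` {y. y ^ 2 = 1 - 4 * n} \<subseteq> {x. x * (1 - x) = n}"
      proof clarify
        fix y :: 'a assume y: "y ^ 2 = 1 - 4 * n"
        define z where "z = (1 - y) / 2"
        have "2 * z = 1 - y" using two by (simp add: z_def)
        hence yz: "y = 1 - 2 * z" by simp
        have "4 * (z * (1 - z)) = 4 * n" using y unfolding yz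
          by (simp add: power2_eq_square algebra_simps)
        thus "(1 - y) / 2 * (1 - (1 - y) / 2) = n"
          unfolding z_def[symmetric] using four by simp
      qed
      have "2 * ((1 - y) / 2) = 1 - y" for y :: 'a using two by simp
      thus "\<forall>y\<in>{y. y ^ 2 = 1 - 4 * n}. 1 - 2 * ((1 - y) / 2) = y" by (simp only:) simp
    qed (use two in simp)
    thus ?thesis using card_square_roots[OF two, of "1 - 4 * n"] by (simp add: bij_betw_same_card)
  qed
  have "jacobi_sum A A = (\<Sum>x\<in>UNIV. mchar_apply A (x * (1 - x)))"
    by (simp add: jacobi_sum_def mchar_apply_mult)
  also have "\<dots> = (\<Sum>n\<in>UNIV. \<Sum>x\<in>{x. x * (1 - x) = n}. mchar_apply A (x * (1 - x)))"
    using sum.group[of UNIV UNIV "\<lambda>x. x * (1 - x)" "\<lambda>x. mchar_apply A (x * (1 - x))"] by simp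
  also have "\<dots> = (\<Sum>n\<in>UNIV. of_nat (card {x. x * (1 - x) = n}) * mchar_apply A n)"
    by (rule sum.cong) simp_all
  also have "\<dots> = (\<Sum>n\<in>UNIV. mchar_apply A n) + (\<Sum>n\<in>UNIV. mchar_apply A n * mchar_apply quadratic_mchar (1 - 4 * n))"
    unfolding card by (simp add: ring_distribs sum.distrib mult.commute)
  also have "(\<Sum>n\<in>UNIV. mchar_apply A n) = 0" using A by (simp add: sum_mchar_apply)
  also have "(\<Sum>n\<in>UNIV. mchar_apply A n * mchar_apply quadratic_mchar (1 - 4 * n)) =
      inverse (mchar_apply A 4) * (\<Sum>n\<in>UNIV. mchar_apply A (4 * n) * mchar_apply quadratic_mchar (1 - 4 * n))"
    unfolding sum_distrib_left by (rule sum.cong) (use four in \<open>simp_all add: mchar_apply_mult\<close>)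
  also have "(\<Sum>n\<in>UNIV. mchar_apply A (4 * n) * mchar_apply quadratic_mchar (1 - 4 * n)) = jacobi_sum A quadratic_mchar"
    unfolding jacobi_sum_def
    by (rule sum_UNIV_mult_field[OF four, of "\<lambda>n. mchar_apply A n * mchar_apply quadratic_mchar (1 - n)"])
  finally show ?thesis by simp
qed

text \<open>For s \<noteq> 0 the substitution of s x for x pulls out (A B)(s). At s = 0 only B(-1)
  times the sum of A B remains, which is the source of every exceptional term for A B = 1.\<close>

lemma sum_mchar_mult_shift:
  fixes A :: "'a :: finite_field mchar"
  shows "(\<Sum>x\<in>UNIV. mchar_apply A x * mchar_apply B (s - x)) =
     mchar_apply (A * B) s * jacobi_sum A B +
     (if s = 0 \<and> A * B = 1 then mchar_apply B (-1) * of_nat (CARD('a) - 1) else 0)"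
proof (cases "s = 0")
  case True
  have neg: "mchar_apply B (s - x) = mchar_apply B (-1) * mchar_apply B x" for x
    using mchar_apply_mult[of B "-1" x] True by simp
  have "(\<Sum>x\<in>UNIV. mchar_apply A x * mchar_apply B (s - x)) =
      mchar_apply B (-1) * (\<Sum>x\<in>UNIV. mchar_apply (A * B) x)"
    by (simp only: neg sum_distrib_left mchar_mult_apply mult_ac)
  thus ?thesis using True by (simp add: sum_mchar_apply del: mchar_mult_apply)
next
  case False
  have "(\<Sum>x\<in>UNIV. mchar_apply A x * mchar_apply B (s - x)) =
      (\<Sum>x\<in>UNIV. mchar_apply A (s * x) * mchar_apply B (s - s * x))"
    by (rule sum_UNIV_mult_field[OF False, symmetric])
  also have "\<dots> = (\<Sum>x\<in>UNIV. mchar_apply (A * B) s * (mchar_apply A x * mchar_apply B (1 - x)))"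
  proof (rule sum.cong)
    fix x
    have "mchar_apply B (s - s * x) = mchar_apply B s * mchar_apply B (1 - x)"
      by (simp add: mchar_apply_mult[symmetric] ring_distribs)
    thus "mchar_apply A (s * x) * mchar_apply B (s - s * x) =
        mchar_apply (A * B) s * (mchar_apply A x * mchar_apply B (1 - x))"
      by (simp add: mchar_apply_mult)
  qed simp
  finally show ?thesis using False by (simp add: jacobi_sum_def sum_distrib_left)
qed

section \<open>Gauss sums and the quadratic Hasse-Davenport relation\<close>

context additive_character
begin

definition gauss_sum :: "'a mchar \<Rightarrow> complex" where
  "gauss_sum A = (\<Sum>x\<in>UNIV. mchar_apply A x * \<psi> x)"

lemma sum_psi: "(\<Sum>x\<in>UNIV. \<psi> x) = 0"
proof -
  obtain c where c: "\<psi> c \<noteq> 1" using psi_nontrivial by blast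
  have "(\<Sum>x\<in>UNIV. \<psi> x) = \<psi> c * (\<Sum>x\<in>UNIV. \<psi> x)"
    using sum_UNIV_add_group[of \<psi> c] by (simp add: psi_add sum_distrib_left)
  thus ?thesis using c by simp
qed

lemma sum_psi_mult: "(\<Sum>x\<in>UNIV. \<psi> (c * x)) = (if c = 0 then of_nat CARD('a) else 0)"
  using sum_UNIV_mult_field[of c \<psi>] by (auto simp: sum_psi)

text \<open>Read from right to left, this expands a character value in additive characters. For A
  \<noteq> 1 the expansion is valid even at c = 0, where both sides vanish.\<close>

lemma gauss_sum_scale:
  assumes "c \<noteq> 0 \<or> A \<noteq> 1"
  shows "(\<Sum>x\<in>UNIV. mchar_apply A x * \<psi> (c * x)) = mchar_apply (inverse A) c * gauss_sum A"
proof (cases "c = 0")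
  case True
  thus ?thesis using assms by (simp add: sum_mchar_apply)
next
  case False
  have "gauss_sum A = mchar_apply A c * (\<Sum>x\<in>UNIV. mchar_apply A x * \<psi> (c * x))"
    using sum_UNIV_mult_field[OF False, of "\<lambda>x. mchar_apply A x * \<psi> x"]
    by (simp add: gauss_sum_def mchar_apply_mult sum_distrib_left mult.assoc)
  thus ?thesis using False by simp
qed

lemma gauss_sum_1: "gauss_sum 1 = -1"
proof -
  have "gauss_sum 1 = (\<Sum>x\<in>UNIV - {0}. \<psi> x)"
    unfolding gauss_sum_def by (rule sum.mono_neutral_cong_right) (auto simp: mchar_one_apply)
  also have "\<dots> = -1" using sum_psi by (simp add: sum_diff1)
  finally show ?thesis .
qed

text \<open>Expanding A^-1(y) G(A) as a sum over x leaves the inner sum of \<psi>((x + 1) y) over y,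
  which vanishes unless x = -1.\<close>

lemma gauss_sum_inverse:
  assumes "A \<noteq> 1"
  shows "gauss_sum A * gauss_sum (inverse A) = mchar_apply A (-1) * of_nat CARD('a)"
proof -
  have "gauss_sum A * gauss_sum (inverse A) =
      (\<Sum>y\<in>UNIV. (mchar_apply (inverse A) y * gauss_sum A) * \<psi> y)"
    by (simp add: gauss_sum_def[of "inverse A"] sum_distrib_left mult_ac)
  also have "\<dots> = (\<Sum>y\<in>UNIV. (\<Sum>x\<in>UNIV. mchar_apply A x * \<psi> (y * x)) * \<psi> y)"
    using assms by (simp add: gauss_sum_scale)
  also have "\<dots> = (\<Sum>y\<in>UNIV. \<Sum>x\<in>UNIV. mchar_apply A x * \<psi> ((x + 1) * y))"
    by (simp add: sum_distrib_left psi_add ring_distribs mult_ac)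
  also have "\<dots> = (\<Sum>x\<in>UNIV. \<Sum>y\<in>UNIV. mchar_apply A x * \<psi> ((x + 1) * y))"
    by (rule sum.swap)
  also have "\<dots> = (\<Sum>x\<in>UNIV. mchar_apply A x * (if x + 1 = 0 then of_nat CARD('a) else 0))"
    by (simp only: sum_distrib_left[symmetric] sum_psi_mult)
  also have "\<dots> = (\<Sum>x\<in>UNIV. if x = (-1 :: 'a) then mchar_apply A (-1) * of_nat CARD('a) else 0)"
    by (rule sum.cong) (auto dest: eq_neg_iff_add_eq_0[THEN iffD2])
  also have "\<dots> = mchar_apply A (-1) * of_nat CARD('a)" by simp
  finally show ?thesis .
qed

lemma gauss_sum_nonzero: "gauss_sum A \<noteq> 0"
proof (cases "A = 1")
  case False
  have "mchar_apply A (-1) * of_nat CARD('a) \<noteq> 0" by simp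
  thus ?thesis using gauss_sum_inverse[OF False] by auto
qed (simp add: gauss_sum_1)

lemma gauss_sum_mult:
  "gauss_sum A * gauss_sum B = jacobi_sum A B * gauss_sum (A * B) +
     (if A * B = 1 then mchar_apply B (-1) * of_nat (CARD('a) - 1) else 0)"
proof -
  let ?e = "if A * B = 1 then mchar_apply B (-1) * of_nat (CARD('a) - 1) else 0"
  have "gauss_sum A * gauss_sum B =
      (\<Sum>x\<in>UNIV. \<Sum>y\<in>UNIV. mchar_apply A x * mchar_apply B y * \<psi> (x + y))"
    by (simp add: gauss_sum_def sum_product psi_add mult_ac)
  also have "\<dots> = (\<Sum>x\<in>UNIV. \<Sum>s\<in>UNIV. mchar_apply A x * mchar_apply B (s - x) * \<psi> s)"
  proof (rule sum.cong)
    fix x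
    show "(\<Sum>y\<in>UNIV. mchar_apply A x * mchar_apply B y * \<psi> (x + y)) =
        (\<Sum>s\<in>UNIV. mchar_apply A x * mchar_apply B (s - x) * \<psi> s)"
      using sum_UNIV_add_group[of "\<lambda>s. mchar_apply A x * mchar_apply B (s - x) * \<psi> s" x] by simp
  qed simp
  also have "\<dots> = (\<Sum>s\<in>UNIV. \<Sum>x\<in>UNIV. mchar_apply A x * mchar_apply B (s - x) * \<psi> s)"
    by (rule sum.swap)
  also have "\<dots> = (\<Sum>s\<in>UNIV. jacobi_sum A B * (mchar_apply (A * B) s * \<psi> s) + (if s = 0 then ?e else 0))"
  proof (rule sum.cong)
    fix s
    show "(\<Sum>x\<in>UNIV. mchar_apply A x * mchar_apply B (s - x) * \<psi> s) =
        jacobi_sum A B * (mchar_apply (A * B) s * \<psi> s) + (if s = 0 then ?e else 0)"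
      unfolding sum_distrib_right[symmetric] sum_mchar_mult_shift by (cases "s = 0") simp_all
  qed simp
  also have "\<dots> = jacobi_sum A B * gauss_sum (A * B) + ?e"
    by (simp add: sum.distrib gauss_sum_def sum_distrib_left)
  finally show ?thesis .
qed

text \<open>
  The factor depends on \<open>A * B\<close> only, so that quotients of Jacobi sums with the same product
  need no case distinction.
\<close>

definition jacobi_factor :: "'a mchar \<Rightarrow> complex" where
  "jacobi_factor C = (if C = 1 then - 1 / of_nat CARD('a) else 1 / gauss_sum C)"

lemma jacobi_factor_nonzero: "jacobi_factor C \<noteq> 0"
  by (simp add: jacobi_factor_def gauss_sum_nonzero)

text \<open>For \<open>A * B = 1\<close> both sides are -A(-1), which explains the value -1/q in
  \<open>jacobi_factor\<close>. The excluded pair A = B = 1 has Jacobi sum q - 2.\<close>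

lemma jacobi_sum_eq:
  assumes "A \<noteq> 1 \<or> A * B \<noteq> 1"
  shows "jacobi_sum A B = gauss_sum A * gauss_sum B * jacobi_factor (A * B)"
proof (cases "A * B = 1")
  case True
  hence A: "A \<noteq> 1" using assms by simp
  have B: "inverse A = B" using True by (rule mchar_inverse_unique)
  have "mchar_apply A (-1) * mchar_apply B (-1) = 1"
    using arg_cong[OF True, of "\<lambda>\<chi>. mchar_apply \<chi> (-1)"] by (simp add: mchar_one_apply)
  moreover have "mchar_apply A (-1) * mchar_apply A (-1) = 1"
    by (simp flip: mchar_apply_mult)
  ultimately have *: "mchar_apply B (-1) = mchar_apply A (-1)"
    by (metis mult_cancel_left mult_zero_left zero_neq_one)
  have "jacobi_sum A B = mchar_apply A (-1) * of_nat (CARD('a) - 1) - gauss_sum A * gauss_sum B"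
    using gauss_sum_mult[of A B] True * by (simp add: gauss_sum_1)
  moreover have "gauss_sum A * gauss_sum B = mchar_apply A (-1) * of_nat CARD('a)"
    using gauss_sum_inverse[OF A] B by simp
  moreover have "of_nat (CARD('a) - 1) = (of_nat CARD('a) - 1 :: complex)"
    using finite_field_card_gt_1[where 'a = 'a] by (simp add: of_nat_diff)
  ultimately show ?thesis using True by (simp add: jacobi_factor_def algebra_simps)
next
  case False
  thus ?thesis using gauss_sum_mult[of A B] by (simp add: jacobi_factor_def gauss_sum_nonzero)
qed

text \<open>For A^2 \<noteq> 1, write both Jacobi sums in \<open>jacobi_sum_same\<close> by Gauss
  sums and cancel G(A). Otherwise A is 1 or \<phi>, and both sides are the same product.\<close>

theorem Hasse_Davenport_quadratic:
  assumes two: "(2 :: 'a) \<noteq> 0"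
  shows "gauss_sum A * gauss_sum (A * quadratic_mchar) =
    inverse (mchar_apply A 4) * gauss_sum (A * A) * gauss_sum quadratic_mchar"
proof (cases "A * A = 1")
  case False
  hence A: "A \<noteq> 1" by auto
  have A': "A * quadratic_mchar \<noteq> 1"
  proof
    assume "A * quadratic_mchar = 1"
    hence "A * quadratic_mchar * (A * quadratic_mchar) = 1" by simp
    moreover have "A * quadratic_mchar * (A * quadratic_mchar) = A * A * (quadratic_mchar * quadratic_mchar)"
      by (simp only: mult_ac)
    ultimately have "A * A * (quadratic_mchar * quadratic_mchar) = 1" by simp
    with False show False by simp
  qed
  \<comment> \<open>Here a, d, g, h stand for the Gauss sums of A, A^2, \<phi> and A \<phi>, and i
    for A(4)^-1.\<close>
  have cancel: "a * h = i * d * g"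
    if "a * a * (1 / d) = i * (a * g * (1 / h))" "a \<noteq> 0" "d \<noteq> 0" "h \<noteq> 0" for a d g h i :: complex
  proof -
    have "a * (a * h) = (a * a * (1 / d)) * (d * h)" using that(3) by simp
    also have "\<dots> = i * (a * g * (1 / h)) * (d * h)" by (simp only: that(1))
    also have "\<dots> = a * (i * d * g)" using that(4) by simp
    finally show ?thesis using that(2) by (simp only: mult_cancel_left simp_thms)
  qed
  have "jacobi_sum A A = gauss_sum A * gauss_sum A * (1 / gauss_sum (A * A))"
    using jacobi_sum_eq[of A A] A False by (simp add: jacobi_factor_def)
  moreover have "jacobi_sum A quadratic_mchar =
      gauss_sum A * gauss_sum quadratic_mchar * (1 / gauss_sum (A * quadratic_mchar))"
    using jacobi_sum_eq[of A quadratic_mchar] A A' by (simp add: jacobi_factor_def)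
  ultimately have "gauss_sum A * gauss_sum A * (1 / gauss_sum (A * A)) = inverse (mchar_apply A 4) *
      (gauss_sum A * gauss_sum quadratic_mchar * (1 / gauss_sum (A * quadratic_mchar)))"
    using jacobi_sum_same[OF two A] by (simp only:)
  thus ?thesis by (rule cancel) (rule gauss_sum_nonzero)+
next
  case True
  hence "A = 1 \<or> A = quadratic_mchar" using mchar_square_eq_1 by blast
  thus ?thesis
  proof
    assume A: "A = 1"
    have "mchar_apply A 4 = 1" using four_nonzero[OF two] by (simp only: A mchar_one_apply) simp
    thus ?thesis by (simp only: A mult_1 inverse_1)
  next
    assume A: "A = quadratic_mchar"
    have "mchar_apply A 4 = 1" using quadratic_mchar_4[OF two] by (simp only: A)
    thus ?thesis by (simp only: A inverse_1 mult_1) (rule mult.commute)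
  qed
qed

end

section \<open>Mellin transforms of the hypergeometric function and of the character sum\<close>

text \<open>Fourier inversion: summing the transform against \<chi>(t) recovers (q - 1) f(t). The
  value f(0) is invisible to it.\<close>

lemma mchar_transform_inj:
  fixes f g :: "'a :: finite_field \<Rightarrow> complex"
  assumes eq: "\<And>\<chi>. (\<Sum>s\<in>UNIV. mchar_apply (inverse \<chi>) s * f s) = (\<Sum>s\<in>UNIV. mchar_apply (inverse \<chi>) s * g s)"
    and t: "t \<noteq> 0"
  shows "f t = g t"
proof -
  have inv: "(\<Sum>\<chi>\<in>UNIV. mchar_apply \<chi> t * (\<Sum>s\<in>UNIV. mchar_apply (inverse \<chi>) s * f s)) =
      of_nat (CARD('a) - 1) * f t" for f :: "'a \<Rightarrow> complex"
  proof -
    have "(\<Sum>\<chi>\<in>UNIV. mchar_apply \<chi> t * (\<Sum>s\<in>UNIV. mchar_apply (inverse \<chi>) s * f s)) =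
        (\<Sum>\<chi>\<in>UNIV. \<Sum>s\<in>UNIV. mchar_apply \<chi> (t / s) * f s)"
      by (simp add: sum_distrib_left mchar_apply_divide divide_inverse mult.assoc mchar_apply_mult mchar_apply_inverse)
    also have "\<dots> = (\<Sum>s\<in>UNIV. \<Sum>\<chi>\<in>UNIV. mchar_apply \<chi> (t / s) * f s)"
      by (rule sum.swap)
    also have "\<dots> = (\<Sum>s\<in>UNIV. (if t / s = 1 then of_nat (CARD('a) - 1) else 0) * f s)"
      by (simp only: sum_distrib_right[symmetric] sum_over_mchars)
    also have "\<dots> = (\<Sum>s\<in>UNIV. if s = t then of_nat (CARD('a) - 1) * f t else 0)"
      by (rule sum.cong) (use t in auto)
    also have "\<dots> = of_nat (CARD('a) - 1) * f t" by simp
    finally show ?thesis .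
  qed
  have "of_nat (CARD('a) - 1) * f t = of_nat (CARD('a) - 1) * g t"
    unfolding inv[symmetric] eq ..
  moreover have "of_nat (CARD('a) - 1) \<noteq> (0 :: complex)"
    using finite_field_card_gt_1[where 'a = 'a] by (simp del: of_nat_diff)
  ultimately show ?thesis by (simp only: mult_cancel_left simp_thms)
qed

text \<open>The defining series is already an expansion in characters, so the transform extracts one
  coefficient; the q - 1 from orthogonality cancels the normalising denominator.\<close>

lemma mchar_transform_gauss_2F1:
  fixes \<chi> :: "'a :: finite_field mchar"
  shows "(\<Sum>t\<in>UNIV. mchar_apply (inverse \<chi>) t * gauss_2F1 A0 A1 B1 t) =
    of_nat CARD('a) * (mchar_binomial (A0 * \<chi>) \<chi> * mchar_binomial (A1 * \<chi>) (B1 * \<chi>))"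
proof -
  define c where "c = (\<lambda>\<chi>. mchar_binomial (A0 * \<chi>) \<chi> * mchar_binomial (A1 * \<chi>) (B1 * \<chi>))"
  define k :: complex where "k = of_nat CARD('a) / (of_nat CARD('a) - 1)"
  have q: "of_nat (CARD('a) - 1) = (of_nat CARD('a) - 1 :: complex)" "of_nat CARD('a) \<noteq> (1 :: complex)"
    using finite_field_card_gt_1[where 'a = 'a] by (simp_all add: of_nat_diff)
  have F: "gauss_2F1 A0 A1 B1 t = k * (\<Sum>X\<in>UNIV. c X * mchar_apply X t)" for t
    by (simp only: gauss_2F1_def k_def c_def)
  have "(\<Sum>t\<in>UNIV. mchar_apply (inverse \<chi>) t * gauss_2F1 A0 A1 B1 t) =
      (\<Sum>t\<in>UNIV. \<Sum>X\<in>UNIV. k * c X * mchar_apply (inverse \<chi> * X) t)"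
    by (simp only: F sum_distrib_left mchar_mult_apply mult_ac)
  also have "\<dots> = (\<Sum>X\<in>UNIV. \<Sum>t\<in>UNIV. k * c X * mchar_apply (inverse \<chi> * X) t)"
    by (rule sum.swap)
  also have "\<dots> = (\<Sum>X\<in>UNIV. k * c X * (if inverse \<chi> * X = 1 then of_nat (CARD('a) - 1) else 0))"
    by (simp only: sum_distrib_left[symmetric] sum_mchar_apply)
  also have "\<dots> = (\<Sum>X\<in>UNIV. if X = \<chi> then k * c \<chi> * of_nat (CARD('a) - 1) else 0)"
  proof (rule sum.cong)
    fix X
    have "inverse \<chi> * X = 1 \<longleftrightarrow> X = \<chi>"
      using mchar_inverse_unique[of "inverse \<chi>" X] by auto
    thus "k * c X * (if inverse \<chi> * X = 1 then of_nat (CARD('a) - 1) else 0) =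
        (if X = \<chi> then k * c \<chi> * of_nat (CARD('a) - 1) else 0)" by simp
  qed simp
  also have "\<dots> = of_nat CARD('a) * c \<chi>" using q by (simp add: k_def)
  finally show ?thesis by (simp add: c_def)
qed

text \<open>With t = 1 + \<lambda> the quadratic factor is x^2 + \<lambda>; the parameter is t
  because that is the hypergeometric argument.\<close>

definition cubic_mchar_sum :: "'a :: finite_field mchar \<Rightarrow> 'a \<Rightarrow> complex" where
  "cubic_mchar_sum A t = (\<Sum>x\<in>UNIV. mchar_apply A ((x - 1) * (x ^ 2 + t - 1)))"

text \<open>Moving the root 1 to the origin makes the linear factor the monomial u and t the
  constant term of the quadratic, so that an additive character splits into monomials in u, v and
  t.\<close>

lemma cubic_mchar_sum_shift:
  "cubic_mchar_sum A t = (\<Sum>u\<in>UNIV. mchar_apply A u * mchar_apply A (u ^ 2 + 2 * u + t))"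
proof -
  have "(1 + u - 1) * ((1 + u) ^ 2 + t - 1) = u * (u ^ 2 + 2 * u + t)" for u
    by (simp add: power2_eq_square algebra_simps)
  thus ?thesis
    using sum_UNIV_add_group[of "\<lambda>x. mchar_apply A ((x - 1) * (x ^ 2 + t - 1))" 1]
    by (simp only: cubic_mchar_sum_def mchar_apply_mult)
qed

context additive_character
begin

text \<open>
  The substitution \<open>a = u\<^sup>2 v\<close>, \<open>b = 2 u v\<close> on pairs of nonzero elements separates the variables.
\<close>

lemma double_sum_separate:
  assumes two: "(2 :: 'a) \<noteq> 0"
  shows "(\<Sum>u\<in>UNIV. \<Sum>v\<in>UNIV. mchar_apply (inverse B) u * mchar_apply C v * \<psi> (u ^ 2 * v) * \<psi> (2 * u * v)) =
    inverse (mchar_apply B 2) * inverse (mchar_apply C 4) *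
      gauss_sum (inverse (B * C)) * gauss_sum (B * C * C)"
proof -
  let ?N = "(UNIV - {0 :: 'a}) \<times> (UNIV - {0 :: 'a})"
  have four: "(4 :: 'a) \<noteq> 0" by (rule four_nonzero[OF two])
  have "(\<Sum>u\<in>UNIV. \<Sum>v\<in>UNIV. mchar_apply (inverse B) u * mchar_apply C v * \<psi> (u ^ 2 * v) * \<psi> (2 * u * v)) =
      (\<Sum>(u, v)\<in>?N. mchar_apply (inverse B) u * mchar_apply C v * \<psi> (u ^ 2 * v) * \<psi> (2 * u * v))"
    unfolding sum.cartesian_product by (rule sum.mono_neutral_right) auto
  also have "\<dots> = (\<Sum>(a, b)\<in>?N. inverse (mchar_apply B 2) * inverse (mchar_apply C 4) *
      (mchar_apply (inverse (B * C)) a * \<psi> a * (mchar_apply (B * C * C) b * \<psi> b)))"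
  \<comment> \<open>From a / b = u / 2 one gets u = 2a / b, and then v = a / u^2 = b^2 / (4a). The
    characters collect to (B C)^-1 at a and B C^2 at b, with constants B(2)^-1 and C(4)^-1.\<close>
  proof (rule sum.reindex_bij_witness[of _ "\<lambda>(a, b). (2 * a / b, b ^ 2 / (4 * a))" "\<lambda>(u, v). (u ^ 2 * v, 2 * u * v)"])
    fix w assume "w \<in> ?N"
    then obtain u v where w: "w = (u, v)" "u \<noteq> 0" "v \<noteq> 0" by auto
    show "(case (case w of (u, v) \<Rightarrow> (u ^ 2 * v, 2 * u * v)) of (a, b) \<Rightarrow> (2 * a / b, b ^ 2 / (4 * a))) = w"
      using w two four by (simp add: power2_eq_square field_simps)
    show "(case w of (u, v) \<Rightarrow> (u ^ 2 * v, 2 * u * v)) \<in> ?N" using w two by simp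
    have "mchar_apply B 4 = mchar_apply B 2 * mchar_apply B 2" for B :: "'a mchar"
      by (simp flip: mchar_apply_mult)
    thus "(case case w of (u, v) \<Rightarrow> (u ^ 2 * v, 2 * u * v) of (a, b) \<Rightarrow>
        inverse (mchar_apply B 2) * inverse (mchar_apply C 4) *
        (mchar_apply (inverse (B * C)) a * \<psi> a * (mchar_apply (B * C * C) b * \<psi> b))) =
      (case w of (u, v) \<Rightarrow> mchar_apply (inverse B) u * mchar_apply C v * \<psi> (u ^ 2 * v) * \<psi> (2 * u * v))"
      using w two by (simp add: mchar_apply_mult power2_eq_square field_simps)
  next
    fix z assume "z \<in> ?N"
    then obtain a b where z: "z = (a, b)" "a \<noteq> 0" "b \<noteq> 0" by auto
    show "(case (case z of (a, b) \<Rightarrow> (2 * a / b, b ^ 2 / (4 * a))) of (u, v) \<Rightarrow> (u ^ 2 * v, 2 * u * v)) = z"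
      using z two four by (simp add: power2_eq_square field_simps)
    show "(case z of (a, b) \<Rightarrow> (2 * a / b, b ^ 2 / (4 * a))) \<in> ?N" using z two four by simp
  qed
  also have "\<dots> = (\<Sum>(a, b)\<in>UNIV. inverse (mchar_apply B 2) * inverse (mchar_apply C 4) *
      (mchar_apply (inverse (B * C)) a * \<psi> a * (mchar_apply (B * C * C) b * \<psi> b)))"
    by (rule sum.mono_neutral_left) auto
  also have "\<dots> = inverse (mchar_apply B 2) * inverse (mchar_apply C 4) *
      ((\<Sum>a\<in>UNIV. mchar_apply (inverse (B * C)) a * \<psi> a) * (\<Sum>b\<in>UNIV. mchar_apply (B * C * C) b * \<psi> b))"
    by (simp only: sum_product) (simp only: sum_distrib_left sum.cartesian_product UNIV_Times_UNIV case_prod_unfold)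
  finally show ?thesis by (simp only: gauss_sum_def mult.assoc)
qed

text \<open>The factor G(B) lets B^-1 of the quadratic be expanded as a sum over v, also at its
  zeros since B \<noteq> 1. Summing over t first gives G(X^-1) X(v), and
  \<open>double_sum_separate\<close> with C = B X finishes.\<close>

lemma mchar_transform_cubic_sum:
  assumes two: "(2 :: 'a) \<noteq> 0" and B: "B \<noteq> 1"
  shows "gauss_sum B * (\<Sum>t\<in>UNIV. mchar_apply (inverse X) t * cubic_mchar_sum (inverse B) t) =
    inverse (mchar_apply B 2) * inverse (mchar_apply (B * X) 4) *
      gauss_sum (inverse X) * gauss_sum (inverse (B * (B * X))) * gauss_sum (B * (B * X) * (B * X))"
proof -
  let ?f = "\<lambda>t u v. mchar_apply (inverse X) t * (mchar_apply (inverse B) u * (mchar_apply B v * \<psi> ((u ^ 2 + 2 * u + t) * v)))"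
  have "gauss_sum B * cubic_mchar_sum (inverse B) t =
      (\<Sum>u\<in>UNIV. mchar_apply (inverse B) u * (mchar_apply (inverse B) (u ^ 2 + 2 * u + t) * gauss_sum B))" for t
    by (simp add: cubic_mchar_sum_shift sum_distrib_left mult_ac)
  hence 1: "gauss_sum B * cubic_mchar_sum (inverse B) t =
      (\<Sum>u\<in>UNIV. mchar_apply (inverse B) u * (\<Sum>v\<in>UNIV. mchar_apply B v * \<psi> ((u ^ 2 + 2 * u + t) * v)))" for t
    using B by (simp only: gauss_sum_scale simp_thms)
  have "gauss_sum B * (\<Sum>t\<in>UNIV. mchar_apply (inverse X) t * cubic_mchar_sum (inverse B) t) =
      (\<Sum>t\<in>UNIV. mchar_apply (inverse X) t * (gauss_sum B * cubic_mchar_sum (inverse B) t))"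
    by (simp only: sum_distrib_left mult.left_commute)
  also have "\<dots> = (\<Sum>t\<in>UNIV. \<Sum>u\<in>UNIV. \<Sum>v\<in>UNIV. ?f t u v)"
    by (simp only: 1 sum_distrib_left)
  also have "\<dots> = (\<Sum>u\<in>UNIV. \<Sum>t\<in>UNIV. \<Sum>v\<in>UNIV. ?f t u v)" by (rule sum.swap)
  also have "\<dots> = (\<Sum>u\<in>UNIV. \<Sum>v\<in>UNIV. \<Sum>t\<in>UNIV. ?f t u v)" by (intro sum.cong refl sum.swap)
  also have "\<dots> = (\<Sum>u\<in>UNIV. \<Sum>v\<in>UNIV. gauss_sum (inverse X) *
      (mchar_apply (inverse B) u * mchar_apply (B * X) v * \<psi> (u ^ 2 * v) * \<psi> (2 * u * v)))"
  proof (intro sum.cong refl)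
    fix u v :: 'a
    have "(\<Sum>t\<in>UNIV. ?f t u v) = mchar_apply (inverse B) u * mchar_apply B v * \<psi> (u ^ 2 * v) * \<psi> (2 * u * v) *
        (\<Sum>t\<in>UNIV. mchar_apply (inverse X) t * \<psi> (v * t))"
      by (simp add: sum_distrib_left ring_distribs psi_add mult_ac)
    also have "\<dots> = gauss_sum (inverse X) *
      (mchar_apply (inverse B) u * mchar_apply (B * X) v * \<psi> (u ^ 2 * v) * \<psi> (2 * u * v))"
      \<comment> \<open>At v = 0 the scaling rule may fail for X = 1, but B(v) = 0 makes both sides
        vanish.\<close>
      using gauss_sum_scale[of v "inverse X"] by (cases "v = 0") (simp_all only:, simp_all)
    finally show "(\<Sum>t\<in>UNIV. ?f t u v) = gauss_sum (inverse X) *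
      (mchar_apply (inverse B) u * mchar_apply (B * X) v * \<psi> (u ^ 2 * v) * \<psi> (2 * u * v))" .
  qed
  also have "\<dots> = gauss_sum (inverse X) * (inverse (mchar_apply B 2) * inverse (mchar_apply (B * X) 4) *
      gauss_sum (inverse (B * (B * X))) * gauss_sum (B * (B * X) * (B * X)))"
    by (simp only: sum_distrib_left[symmetric] double_sum_separate[OF two])
  finally show ?thesis by (simp only: mult_ac)
qed

lemma mchar_minus_one_square: "mchar_apply (A :: 'a mchar) (-1) * mchar_apply A (-1) = 1"
  by (simp flip: mchar_apply_mult)

lemma cubic_mchar_sum_eq_gauss_2F1:
  fixes T :: "'a mchar"
  defines "\<phi> \<equiv> quadratic_mchar"
  assumes two: "(2 :: 'a) \<noteq> 0" and T2: "T ^ 2 \<noteq> 1" and T3: "T ^ 3 * \<phi> \<noteq> 1" and t: "t \<noteq> 0"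
  shows "cubic_mchar_sum (inverse (T ^ 2)) t =
    of_nat CARD('a) * (jacobi_sum \<phi> (inverse (T ^ 2)) / jacobi_sum T (inverse (T ^ 3) * \<phi>) *
      gauss_2F1 (T ^ 3 * \<phi>) (T ^ 3) (T ^ 4) t)"
proof -
  define q :: complex where "q = of_nat CARD('a)"
  have q0: "q \<noteq> 0" by (simp add: q_def)
  define c where "c = jacobi_sum \<phi> (inverse (T ^ 2)) / jacobi_sum T (inverse (T ^ 3) * \<phi>)"
  note nz = gauss_sum_nonzero jacobi_factor_nonzero
  have \<phi>: "\<phi> \<noteq> 1" "inverse \<phi> = \<phi>" using quadratic_mchar_neq_1[OF two] by (simp_all add: \<phi>_def)
  have T: "T \<noteq> 1" using T2 by auto
  define s where "s = mchar_apply T (-1)"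
  have s: "s * s = 1" unfolding s_def by (rule mchar_minus_one_square)
  define e where "e = mchar_apply \<phi> (-1)"
  have g\<phi>: "gauss_sum \<phi> * gauss_sum \<phi> = e * q"
    using gauss_sum_inverse[OF \<phi>(1)] by (simp add: \<phi>(2) e_def q_def)
  have gT: "gauss_sum T * gauss_sum (inverse T) = s * q"
    using gauss_sum_inverse[OF T] by (simp add: s_def q_def)
  have gT2: "gauss_sum (T ^ 2) * gauss_sum (inverse (T ^ 2)) = q"
    using gauss_sum_inverse[OF T2] s by (simp add: q_def power2_eq_square s_def)
  have "inverse (T ^ 3 * \<phi>) = inverse (T ^ 3) * \<phi>" by (simp add: mchar_inverse_mult_distrib \<phi>)
  hence gT3: "gauss_sum (T ^ 3 * \<phi>) * gauss_sum (inverse (T ^ 3) * \<phi>) = s * e * q"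
    using gauss_sum_inverse[OF T3] s by (simp add: q_def power3_eq_cube s_def e_def)
  \<comment> \<open>Both Jacobi sums in \<open>c\<close> have the same product of characters, so
    their \<open>jacobi_factor\<close> cancels, even if that product is trivial.\<close>
  have TT: "T * (inverse (T ^ 3) * \<phi>) = \<phi> * inverse (T ^ 2)"
  proof -
    have "T * (inverse (T ^ 3) * \<phi>) = (T * inverse T) * (\<phi> * inverse (T ^ 2))"
      by (simp only: power3_eq_cube power2_eq_square mchar_inverse_mult_distrib mult_ac)
    thus ?thesis by simp
  qed
  have c: "c * (gauss_sum T * gauss_sum (inverse (T ^ 3) * \<phi>)) = gauss_sum \<phi> * gauss_sum (inverse (T ^ 2))"
    using \<phi> T by (simp add: c_def jacobi_sum_eq TT nz)
  \<comment> \<open>After multiplication by \<open>?P\<close>, each side is a product of two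
    reflection pairs G(A) G(A^-1), hence equal to e q^2, as s^2 = 1.\<close>
  have key: "c * gauss_sum \<phi> * gauss_sum (T ^ 2) = gauss_sum (T ^ 3 * \<phi>) * gauss_sum (inverse T)"
  proof -
    let ?P = "gauss_sum T * gauss_sum (inverse (T ^ 3) * \<phi>)"
    have "c * gauss_sum \<phi> * gauss_sum (T ^ 2) * ?P = (c * ?P) * (gauss_sum \<phi> * gauss_sum (T ^ 2))"
      by (simp only: mult_ac)
    also have "\<dots> = (gauss_sum \<phi> * gauss_sum \<phi>) * (gauss_sum (T ^ 2) * gauss_sum (inverse (T ^ 2)))"
      unfolding c by (simp only: mult_ac)
    also have "\<dots> = (s * s) * (e * q * q)" unfolding g\<phi> gT2 s by simp
    also have "\<dots> = (s * e * q) * (s * q)" by (simp only: mult_ac)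
    also have "\<dots> = gauss_sum (T ^ 3 * \<phi>) * gauss_sum (inverse T) * ?P"
      unfolding gT[symmetric] gT3[symmetric] by (simp only: mult_ac)
    finally show ?thesis by (simp add: nz)
  qed
  have frac: "w * z / p = z / d" if "w * d = p" "d \<noteq> 0" "p \<noteq> 0" for w z p d :: complex
    using that by (auto simp: field_simps)
  have "q * c * gauss_2F1 (T ^ 3 * \<phi>) (T ^ 3) (T ^ 4) t = cubic_mchar_sum (inverse (T ^ 2)) t"
  proof (rule mchar_transform_inj[OF _ t])
    fix X :: "'a mchar"
    let ?Z = "gauss_sum (inverse X) * gauss_sum (inverse (T ^ 4 * X)) * gauss_sum (T ^ 6 * X ^ 2) *
        inverse (mchar_apply (T ^ 3 * X) 4)"
    have J1: "jacobi_sum (T ^ 3 * \<phi> * X) (inverse X) =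
        gauss_sum (T ^ 3 * \<phi> * X) * gauss_sum (inverse X) / gauss_sum (T ^ 3 * \<phi>)"
      using T3 jacobi_sum_eq[of "T ^ 3 * \<phi> * X" "inverse X"] by (simp add: jacobi_factor_def mult.assoc)
    have "T ^ 4 * X = T * (T ^ 3 * X)" by (simp add: eval_nat_numeral mult_ac)
    hence "T ^ 3 * X * inverse (T ^ 4 * X) = inverse T * ((T ^ 3 * X) * inverse (T ^ 3 * X))"
      by (simp only: mchar_inverse_mult_distrib mult_ac)
    hence "T ^ 3 * X * inverse (T ^ 4 * X) = inverse T" by simp
    hence J2: "jacobi_sum (T ^ 3 * X) (inverse (T ^ 4 * X)) =
        gauss_sum (T ^ 3 * X) * gauss_sum (inverse (T ^ 4 * X)) / gauss_sum (inverse T)"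
      using T jacobi_sum_eq[of "T ^ 3 * X" "inverse (T ^ 4 * X)"] by (simp add: jacobi_factor_def)
    have "mchar_apply X (-1) * mchar_apply (T ^ 4 * X) (-1) = (s * s) * (s * s) * (mchar_apply X (-1) * mchar_apply X (-1))"
      by (simp add: eval_nat_numeral s_def mult_ac)
    \<comment> \<open>The signs of the two binomial coefficients cancel, since the squares X^2 and
      T^4 are 1 at -1.\<close>
    hence sign: "mchar_apply X (-1) * mchar_apply (T ^ 4 * X) (-1) = 1"
      by (simp only: s mchar_minus_one_square mult_1)
    have "T ^ 3 * X * (T ^ 3 * X) = T ^ 6 * X ^ 2"
      by (simp add: eval_nat_numeral mult_ac)
    hence HD: "gauss_sum (T ^ 3 * X) * gauss_sum (T ^ 3 * \<phi> * X) =
        inverse (mchar_apply (T ^ 3 * X) 4) * gauss_sum (T ^ 6 * X ^ 2) * gauss_sum \<phi>"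
      using Hasse_Davenport_quadratic[OF two, of "T ^ 3 * X"] by (simp add: \<phi>_def mult_ac)
    have "(\<Sum>t\<in>UNIV. mchar_apply (inverse X) t * (q * c * gauss_2F1 (T ^ 3 * \<phi>) (T ^ 3) (T ^ 4) t)) =
        q * c * (\<Sum>t\<in>UNIV. mchar_apply (inverse X) t * gauss_2F1 (T ^ 3 * \<phi>) (T ^ 3) (T ^ 4) t)"
      by (simp only: sum_distrib_left mult_ac)
    also have "\<dots> = q * c * (q * (mchar_apply X (-1) / q * jacobi_sum (T ^ 3 * \<phi> * X) (inverse X) *
        (mchar_apply (T ^ 4 * X) (-1) / q * jacobi_sum (T ^ 3 * X) (inverse (T ^ 4 * X)))))"
      by (simp only: mchar_transform_gauss_2F1 mchar_binomial_def q_def)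
    also have "\<dots> = c * (mchar_apply X (-1) * mchar_apply (T ^ 4 * X) (-1)) *
        (jacobi_sum (T ^ 3 * \<phi> * X) (inverse X) * jacobi_sum (T ^ 3 * X) (inverse (T ^ 4 * X)))"
      using q0 by (simp add: field_simps del: mchar_mult_apply)
    also have "\<dots> = c * (gauss_sum (T ^ 3 * X) * gauss_sum (T ^ 3 * \<phi> * X)) *
        gauss_sum (inverse X) * gauss_sum (inverse (T ^ 4 * X)) / (gauss_sum (T ^ 3 * \<phi>) * gauss_sum (inverse T))"
      unfolding sign J1 J2 by (simp add: field_simps)
    also have "\<dots> = c * gauss_sum \<phi> * ?Z / (gauss_sum (T ^ 3 * \<phi>) * gauss_sum (inverse T))"
      unfolding HD by (simp only: mult_ac)
    also have "\<dots> = ?Z / gauss_sum (T ^ 2)"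
      by (rule frac[OF key]) (simp_all add: nz)
    also have "\<dots> = (\<Sum>t\<in>UNIV. mchar_apply (inverse X) t * cubic_mchar_sum (inverse (T ^ 2)) t)"
    proof -
      have 1: "T ^ 2 * (T ^ 2 * X) = T ^ 4 * X" "T ^ 4 * X * (T ^ 2 * X) = T ^ 6 * X ^ 2"
        by (simp_all add: eval_nat_numeral mult_ac)
      \<comment> \<open>The constants of the two transforms agree because T^2(2) = T(4).\<close>
      have "mchar_apply (T ^ 2) 2 * mchar_apply (T ^ 2 * X) 4 = mchar_apply (T ^ 3 * X) 4"
      proof -
        have "mchar_apply (T ^ 2) 2 = mchar_apply T (2 * 2)"
          by (simp only: power2_eq_square mchar_mult_apply mchar_apply_mult)
        also have "(2 * 2 :: 'a) = 4" by simp
        finally show ?thesis by (simp add: eval_nat_numeral mult_ac)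
      qed
      hence 2: "inverse (mchar_apply (T ^ 2) 2) * inverse (mchar_apply (T ^ 2 * X) 4) =
          inverse (mchar_apply (T ^ 3 * X) 4)"
        by (simp only: inverse_mult_distrib[symmetric])
      have "x * y * z * k / d = w" if "d * w = k * x * y * z" "d \<noteq> 0" for x y z k d w :: complex
        using that by (simp add: divide_eq_eq mult_ac)
      from this[OF mchar_transform_cubic_sum[OF two T2, of X, unfolded 1 2] nz(1)] show ?thesis .
    qed
    finally show "(\<Sum>t\<in>UNIV. mchar_apply (inverse X) t * (q * c * gauss_2F1 (T ^ 3 * \<phi>) (T ^ 3) (T ^ 4) t)) =
        (\<Sum>t\<in>UNIV. mchar_apply (inverse X) t * cubic_mchar_sum (inverse (T ^ 2)) t)" .
  qed
  from this[symmetric] show ?thesis by (simp only: q_def c_def mult.assoc)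
qed

end

section \<open>Point counts, reduction of the parameter, and the theorem\<close>

lemma mchar_has_order_power_eq_1_iff:
  assumes "mchar_has_order S l"
  shows "S ^ n = 1 \<longleftrightarrow> l dvd n"
proof
  have l: "l > 0" "S ^ l = 1" and min: "\<And>k. 0 < k \<Longrightarrow> k < l \<Longrightarrow> S ^ k \<noteq> 1"
    using assms by (auto simp: mchar_has_order_def)
  {
    assume "S ^ n = 1"
    moreover have "S ^ n = S ^ (l * (n div l) + n mod l)" by simp
    hence "S ^ n = S ^ (n mod l)" by (simp only: power_add power_mult l power_one mult_1)
    ultimately have "S ^ (n mod l) = 1" by simp
    hence "n mod l = 0" using min[of "n mod l"] l by auto
    thus "l dvd n" by auto
  }
  assume "l dvd n"
  thus "S ^ n = 1" using l by (auto simp: power_mult)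
qed

lemma card_affine_points:
  fixes S :: "'a :: finite_field mchar"
  assumes S: "mchar_has_order S l"
  shows "of_nat (card (affine_points l a)) =
    of_nat CARD('a) + (\<Sum>i\<in>{1..<l}. cubic_mchar_sum (S ^ i) (1 + a))"
proof -
  have l: "l > 0" using S by (simp add: mchar_has_order_def)
  have root: "of_nat (card {y. y ^ l = c}) = 1 + (\<Sum>i\<in>{1..<l}. mchar_apply (S ^ i) c)" for c
  proof (cases "c = 0")
    \<comment> \<open>At c = 0 there is one root, but every character vanishes; so the trivial power
      must appear as the constant 1.\<close>
    case True
    thus ?thesis using l by simp
  next
    case False
    have "{..<l} = insert 0 {1..<l}" using l by auto
    thus ?thesis using card_power_eq[OF S False] False by (simp add: mchar_one_apply)
  qed
  have "affine_points l a = (SIGMA x:UNIV. {y. y ^ l = (x - 1) * (x ^ 2 + a)})"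
    by (auto simp: affine_points_def)
  hence "of_nat (card (affine_points l a)) =
      (\<Sum>x\<in>UNIV. of_nat (card {y. y ^ l = (x - 1) * (x ^ 2 + a)}) :: complex)"
    by simp
  also have "\<dots> = of_nat CARD('a) + (\<Sum>x\<in>UNIV. \<Sum>i\<in>{1..<l}. mchar_apply (S ^ i) ((x - 1) * (x ^ 2 + a)))"
    unfolding root by (simp add: sum.distrib)
  also have "(\<Sum>x\<in>UNIV. \<Sum>i\<in>{1..<l}. mchar_apply (S ^ i) ((x - 1) * (x ^ 2 + a))) =
      (\<Sum>i\<in>{1..<l}. \<Sum>x\<in>UNIV. mchar_apply (S ^ i) ((x - 1) * (x ^ 2 + a)))"
    by (rule sum.swap)
  finally show ?thesis by (simp add: cubic_mchar_sum_def)
qed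

text \<open>The point count produces S^i, whereas the hypergeometric identity evaluates the sum for
  T^-2 = S^-i; the index change i to l - i reconciles them.\<close>

lemma sum_inverse_powers_mchar:
  fixes S :: "'a :: field mchar"
  assumes "S ^ l = 1"
  shows "(\<Sum>i\<in>{1..<l}. f (S ^ i)) = (\<Sum>i\<in>{1..<l}. f (inverse (S ^ i)))"
proof (rule sum.reindex_bij_witness[of _ "\<lambda>i. l - i" "\<lambda>i. l - i"])
  fix i assume "i \<in> {1..<l}"
  hence "S ^ (l - i) * S ^ i = 1" using assms by (simp flip: power_add)
  hence "inverse (S ^ (l - i)) = S ^ i" by (rule mchar_inverse_unique)
  thus "f (inverse (S ^ (l - i))) = f (S ^ i)" by simp
qed auto

text \<open>For \<lambda> = a/b in lowest terms, a (a + b) / b^2 is also in lowest terms. Order zero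
  of this quotient therefore excludes p from the denominator and from both a and a + b.\<close>

lemma rat_red_one_plus:
  assumes p: "prime p" "CHAR('a :: field) = p" and lam: "lam \<noteq> 0" "lam \<noteq> -1"
    and ord: "rat_ord p (lam * (lam + 1)) = 0"
  shows "rat_red (1 + lam) = (1 + rat_red lam :: 'a)" "rat_red (1 + lam) \<noteq> (0 :: 'a)"
proof -
  obtain a b where ab: "quotient_of lam = (a, b)" by (cases "quotient_of lam")
  have b: "b > 0" and cop: "coprime a b" and lam_eq: "lam = Fract a b"
    using quotient_of_denom_pos[OF ab] quotient_of_coprime[OF ab] quotient_of_div[OF ab]
    by (simp_all add: Fract_of_int_quotient)
  have cop': "coprime (a + b) b" using cop by (simp add: coprime_iff_gcd_eq_1)
  have "1 + lam = Fract (a + b) b"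
    unfolding lam_eq One_rat_def using b by (simp add: eq_rat algebra_simps)
  hence q1: "quotient_of (1 + lam) = (a + b, b)"
    using b cop' by (simp add: quotient_of_Fract normalize_stable)
  have "lam * (lam + 1) = Fract (a * (a + b)) (b * b)"
    using \<open>1 + lam = _\<close> by (simp add: lam_eq add.commute)
  moreover have "coprime (a * (a + b)) (b * b)" using cop cop' by simp
  ultimately have q2: "quotient_of (lam * (lam + 1)) = (a * (a + b), b * b)"
    using b by (simp add: quotient_of_Fract normalize_stable)
  \<comment> \<open>\<open>multiplicity\<close> of 0 is 0 by convention, so vanishing multiplicity
    means nondivisibility only for nonzero numbers.\<close>
  have a0: "a \<noteq> 0" using lam lam_eq by (auto simp: rat_number_collapse)
  have ab0: "a + b \<noteq> 0"
  proof
    assume "a + b = 0"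
    hence "1 + lam = 0" using \<open>1 + lam = _\<close> by (simp add: rat_number_collapse)
    with lam(2) show False by (simp add: add_eq_0_iff)
  qed
  have pp: "prime (int p)" using p by simp
  have ord': "multiplicity (int p) (a * (a + b)) = multiplicity (int p) (b * b)"
    using ord by (simp add: rat_ord_def q2)
  have "\<not> int p dvd b"
  proof
    assume *: "int p dvd b"
    have "multiplicity (int p) (b * b) > 0"
      using * b pp by (subst multiplicity_gt_zero_iff) auto
    hence "int p dvd a * (a + b)" using ord' not_dvd_imp_multiplicity_0 by fastforce
    hence "int p dvd a \<or> int p dvd a + b" using pp by (simp add: prime_dvd_mult_iff)
    hence "int p dvd a" using * by (auto simp: dvd_add_left_iff)
    with * cop pp show False by (meson coprime_common_divisor not_prime_unit)
  qed
  moreover from this have "multiplicity (int p) (b * b) = 0"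
    using pp by (intro not_dvd_imp_multiplicity_0) (simp add: prime_dvd_mult_iff)
  hence "multiplicity (int p) (a * (a + b)) = 0" using ord' by simp
  hence "\<not> int p dvd a * (a + b)"
    using a0 ab0 pp prime_elem_multiplicity_eq_zero_iff[of "int p" "a * (a + b)"]
    by (simp only: prime_imp_prime_elem mult_eq_0_iff) simp
  ultimately have "(of_int b :: 'a) \<noteq> 0" "(of_int (a + b) :: 'a) \<noteq> 0"
    using p by (auto simp: of_int_eq_0_iff_char_dvd simp del: of_int_add)
  thus "rat_red (1 + lam) = (1 + rat_red lam :: 'a)" "rat_red (1 + lam) \<noteq> (0 :: 'a)"
    by (simp_all add: rat_red_def q1 ab field_simps)
qed

lemma (in additive_character) jacobi_sum_nonzero:
  fixes A :: "'a mchar"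
  assumes "A \<noteq> 1"
  shows "jacobi_sum A B \<noteq> 0"
  using assms by (simp add: jacobi_sum_eq gauss_sum_nonzero jacobi_factor_nonzero)

theorem theorem1p4:
  fixes l p e q :: nat and lam :: rat
    and S :: "'a :: finite_field mchar"
  assumes "l \<ge> 2"
    and "lam \<noteq> 0" and "lam \<noteq> -1"
    and "prime p" and "odd p"
    and "rat_ord p (lam * (lam + 1)) = 0"
    and "q = p ^ e" and "CARD('a) = q"
    and "[q = 1] (mod l)"
    and "mchar_has_order S l"
  shows "(\<not> 3 dvd l \<and> even ((q - 1) div l) \<longrightarrow>
           (\<forall>sqrtS :: int \<Rightarrow> 'a mchar.
              (\<forall>i. sqrtS i ^ 2 = S powi i) \<and> (\<forall>k i. sqrtS (k * i) = sqrtS i powi k) \<longrightarrow>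
              - of_int (curve_trace TYPE('a) l lam) =
                of_nat q * (\<Sum>i = 1..int l - 1.
                  jacobi_sum quadratic_mchar (S powi (- i)) /
                  jacobi_sum (sqrtS i) (sqrtS (- 3 * i) * quadratic_mchar) *
                  gauss_2F1 (sqrtS (3 * i) * quadratic_mchar) (sqrtS (3 * i)) (S powi (2 * i))
                    (rat_red (1 + lam)))))
       \<and> (l = 3 \<longrightarrow>
           - of_int (curve_trace TYPE('a) l lam) =
             2 + of_nat q * (\<Sum>i = 1..2. gauss_2F1 quadratic_mchar 1 (S ^ i) (rat_red (1 + lam))))"
proof -
  note S = \<open>mchar_has_order S l\<close>
  note S_pow = mchar_has_order_power_eq_1_iff[OF S]
  have l: "l > 0" using \<open>l \<ge> 2\<close> by simp
  have card: "CARD('a) = p ^ e" using assms by simp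
  have char: "CHAR('a) = p" by (rule CHAR_eq_if_card_prime_power[OF \<open>prime p\<close> card])
  have two: "(2 :: 'a) \<noteq> 0"
  proof
    assume "(2 :: 'a) = 0"
    hence "p dvd 2" using of_nat_eq_0_iff_char_dvd[of 2, where 'a = 'a] by (simp add: char)
    hence "p = 2" using \<open>prime p\<close> by (simp add: primes_dvd_imp_eq)
    with \<open>odd p\<close> show False by simp
  qed
  obtain \<psi> :: "'a \<Rightarrow> complex" where "additive_character \<psi>"
    using exists_additive_character[OF \<open>prime p\<close> card] by blast
  then interpret additive_character \<psi> .
  define t :: 'a where "t = rat_red (1 + lam)"
  note red = rat_red_one_plus[OF \<open>prime p\<close> char \<open>lam \<noteq> 0\<close> \<open>lam \<noteq> -1\<close> \<open>rat_ord p (lam * (lam + 1)) = 0\<close>]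
  have t: "t \<noteq> 0" using red(2) by (simp add: t_def)
  define N where "N = card (affine_points l (rat_red lam :: 'a))"
  have N: "of_nat N = of_nat q + (\<Sum>i\<in>{1..<l}. cubic_mchar_sum (S ^ i) t)"
    unfolding N_def t_def red(1) card_affine_points[OF S] \<open>CARD('a) = q\<close> ..
  have "- of_int (curve_trace TYPE('a) l lam) =
      of_nat q * (\<Sum>i = 1..int l - 1.
        jacobi_sum quadratic_mchar (S powi (- i)) /
        jacobi_sum (sqrtS i) (sqrtS (- 3 * i) * quadratic_mchar) *
        gauss_2F1 (sqrtS (3 * i) * quadratic_mchar) (sqrtS (3 * i)) (S powi (2 * i)) t)"
    if l3: "\<not> 3 dvd l" and sq: "\<And>i. sqrtS i ^ 2 = S powi i"
      and mult: "\<And>k i. sqrtS (k * i) = sqrtS i powi k" for sqrtS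
  proof -
    have "coprime l 3" using l3 prime_imp_coprime[of 3 l] by (simp add: coprime_commute)
    have summand: "cubic_mchar_sum (inverse (S ^ nat i)) t = of_nat q *
        (jacobi_sum quadratic_mchar (S powi (- i)) /
        jacobi_sum (sqrtS i) (sqrtS (- 3 * i) * quadratic_mchar) *
        gauss_2F1 (sqrtS (3 * i) * quadratic_mchar) (sqrtS (3 * i)) (S powi (2 * i)) t)"
      if i: "i \<in> {1..int l - 1}" for i
    proof -
      define T where "T = sqrtS i"
      have Ti: "S ^ nat i = T ^ 2" using sq[of i] i by (simp add: T_def power_int_def)
      have not_dvd: "\<not> l dvd nat i"
      proof
        assume "l dvd nat i"
        hence "l \<le> nat i" using i by (intro dvd_imp_le) auto
        thus False using i by auto
      qed
      hence T2: "T ^ 2 \<noteq> 1" using S_pow[of "nat i"] Ti by simp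
      \<comment> \<open>Otherwise T^6 = S^(3i) is trivial, so l divides 3i and, being coprime to 3,
        divides i.\<close>
      have T3: "T ^ 3 * quadratic_mchar \<noteq> 1"
      proof
        assume "T ^ 3 * quadratic_mchar = 1"
        hence "inverse (T ^ 3) = quadratic_mchar" by (rule mchar_inverse_unique)
        hence "T ^ 3 = quadratic_mchar" by (metis mchar_inverse_inverse inverse_quadratic_mchar)
        hence "(T ^ 3) ^ 2 = 1" by (simp add: power2_eq_square)
        moreover have "S ^ (nat i * 3) = (T ^ 3) ^ 2"
          unfolding power_mult Ti by (simp flip: power_mult)
        ultimately have "S ^ (nat i * 3) = 1" by simp
        hence "l dvd nat i * 3" by (simp only: S_pow)
        with \<open>coprime l 3\<close> not_dvd show False by (simp add: coprime_dvd_mult_left_iff)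
      qed
      \<comment> \<open>The consistency of the chosen roots turns every character of the summand
        into a power of the single T, possibly inverted.\<close>
      have 1: "sqrtS (3 * i) = T ^ 3" using mult[of 3 i] by (simp add: T_def)
      have 2: "sqrtS (- 3 * i) = inverse (T ^ 3)"
        using mult[of "-3" i] by (simp add: T_def power_int_def mchar_inverse_power)
      have 3: "S powi (2 * i) = T ^ 4"
        using sq[of "2 * i"] mult[of 2 i] by (simp add: T_def flip: power_mult)
      have 4: "S powi (- i) = inverse (T ^ 2)"
        using sq[of "- i"] mult[of "-1" i] by (simp add: T_def power_int_def mchar_inverse_power)
      show ?thesis
        unfolding 1 2 3 4 Ti T_def[symmetric] \<open>CARD('a) = q\<close>[symmetric]
        by (rule cubic_mchar_sum_eq_gauss_2F1[OF two T2 T3 t])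
    qed
    have "card (curve_points l (rat_red lam :: 'a)) = 1 + N"
      unfolding N_def by (rule card_curve_points_coprime[OF l l3])
    hence "- of_int (curve_trace TYPE('a) l lam) = of_nat N - (of_nat q :: complex)"
      by (simp add: curve_trace_def \<open>CARD('a) = q\<close>)
    also have "\<dots> = (\<Sum>i\<in>{1..<l}. cubic_mchar_sum (inverse (S ^ i)) t)"
      using N sum_inverse_powers_mchar[of S l "\<lambda>A. cubic_mchar_sum A t"] S
      by (simp add: mchar_has_order_def)
    also have "\<dots> = (\<Sum>i = 1..int l - 1. cubic_mchar_sum (inverse (S ^ nat i)) t)"
      by (rule sum.reindex_bij_witness[of _ nat int]) auto
    also have "\<dots> = (\<Sum>i = 1..int l - 1. of_nat q *
        (jacobi_sum quadratic_mchar (S powi (- i)) /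
        jacobi_sum (sqrtS i) (sqrtS (- 3 * i) * quadratic_mchar) *
        gauss_2F1 (sqrtS (3 * i) * quadratic_mchar) (sqrtS (3 * i)) (S powi (2 * i)) t))"
      by (rule sum.cong[OF refl summand])
    finally show ?thesis by (simp only: sum_distrib_left)
  qed
  moreover have "- of_int (curve_trace TYPE('a) l lam) =
      2 + of_nat q * (\<Sum>i = 1..2. gauss_2F1 quadratic_mchar 1 (S ^ i) t)" if l3: "l = 3"
  proof -
    have summand: "cubic_mchar_sum (S ^ i) t = of_nat q * gauss_2F1 quadratic_mchar 1 (S ^ i) t"
      if i: "i \<in> {1..<l}" for i
    proof -
      \<comment> \<open>S^i is a square root of its own inverse: T^3 = 1 gives T^2 = T^-1. The
        Jacobi quotient becomes J(\<phi>, T) / J(T, \<phi>) = 1.\<close>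
      define T where "T = S ^ i"
      have "T \<noteq> 1" "T ^ 3 = 1"
        using S_pow[of i] S_pow[of "i * 3"] i l3 unfolding T_def by (auto dest: dvd_imp_le simp: power_mult)
      moreover have "T ^ 2 \<noteq> 1"
        using \<open>T \<noteq> 1\<close> \<open>T ^ 3 = 1\<close> by (auto simp: power3_eq_cube power2_eq_square)
      moreover have "T ^ 4 = T" "inverse (T ^ 2) = T"
        using \<open>T ^ 3 = 1\<close> by (auto simp: eval_nat_numeral mult_ac intro!: mchar_inverse_unique)
      moreover have "jacobi_sum quadratic_mchar T / jacobi_sum T quadratic_mchar = 1"
        using jacobi_sum_nonzero[of quadratic_mchar T] quadratic_mchar_neq_1[OF two]
        by (simp add: jacobi_sum_commute[of T])
      ultimately show ?thesis
        using cubic_mchar_sum_eq_gauss_2F1[OF two, of T t] quadratic_mchar_neq_1[OF two] t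
        by (simp add: T_def \<open>CARD('a) = q\<close>)
    qed
    have "card (curve_points 3 (rat_red lam :: 'a)) = 3 + N"
      unfolding N_def l3 by (rule card_curve_points_3) (use assms l3 in simp)
    \<comment> \<open>Three points at infinity against the 1 in the trace leave the summand
      2.\<close>
    hence "- of_int (curve_trace TYPE('a) l lam) = 2 + (of_nat N - (of_nat q :: complex))"
      by (simp add: curve_trace_def \<open>CARD('a) = q\<close> l3)
    also have "of_nat N - of_nat q = (\<Sum>i\<in>{1..<l}. of_nat q * gauss_2F1 quadratic_mchar 1 (S ^ i) t)"
      using N summand by simp
    also have "{1..<l} = {1..2}" using l3 by auto
    finally show ?thesis by (simp only: sum_distrib_left)
  qed
  ultimately show ?thesis unfolding t_def by blast
qed

end
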